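(* Let $\mathcal F(N,d)$ denote the collection of all forests on $N$ vertices with maximum degree at most $d$. Then for all $0\le p\le 1$, with $q=1-p$, and all $1\le d\le N$, $$\inf_{\widehat{\mathsf{cc}}}\ \sup_{G\in\mathcal F(N,d)}\mathbb E_G|\widehat{\mathsf{cc}}-\mathsf{cc}(G)|^2\ \asymp\ \left(\frac{Nq}{p^2}\vee\frac{Nqd}{p}\right)\wedge N^2.$$
   Context: Graphs are finite, simple and undirected; $\mathsf{cc}(G)$ is the number of connected components of $G$. $x\vee y=\max(x,y)$, $x\wedge y=\min(x,y)$. The notation $A\asymp B$ means that $A$ is bounded above and below by $B$ up to absolute positive multiplicative constants. For $p=0$ the right-hand side is read as $N^2$. Bernoulli sampling model: given a (deterministic, unknown) graph $G=(V,E)$, each vertex is included in a random set $S\subset V$ independently with probability $p$, and one observes the induced subgraph $\widetilde G=G[S]$ (up to isomorphism). An estimator $\widehat{\mathsf{cc}}$ is any real-valued function of $\widetilde G$ (it may depend on the known parameters $N,d,p$); $\mathbb E_G$ is the expectation when the parent graph is $G$.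
   Formalization: The lower bound is stated only for N ≥ 2, because for N = d = 1 and p < 1 the only forest is a single vertex, so the minimax risk is 0 while the right-hand side is positive; the upper bound is stated for all 1 ≤ d ≤ N. *)

theory Defs
  imports "HOL-Probability.Probability" "Graph_Theory.Graph_Theory"
begin

text \<open>
  A finite simple undirected graph is a \<open>pair_graph\<close>: a finite symmetric loop-free set of
  arcs (pairs of vertices) on a finite vertex set, so an edge is a pair of opposite arcs, the degree
  of a vertex is its out-degree, and the connected components are the strongly connected components.
  Vertices are natural numbers; every finite graph has such a copy.
\<close>

type_synonym dgraph = "(nat, nat \<times> nat) pre_digraph"

definition cc :: "dgraph \<Rightarrow> nat" where
  "cc G = card (pre_digraph.sccs G)"

text \<open>
  The predicate \<open>forest\<close> of the graph library is the directed notion: it also excludes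
  the closed walk of length 2 that runs back and forth along an edge. In a \<open>pair_graph\<close>
  the cycles of length at least 3 are exactly the (oriented) cycles of the undirected graph.
\<close>

definition undirected_forest :: "nat pair_pre_digraph \<Rightarrow> bool" where
  "undirected_forest G \<longleftrightarrow>
     pair_graph G \<and> \<not> (\<exists>w. pre_digraph.cycle (with_proj G) w \<and> 3 \<le> length w)"

definition forests :: "nat \<Rightarrow> nat \<Rightarrow> dgraph set" where
  "forests N d = with_proj ` {G. undirected_forest G \<and> card (pverts G) = N \<and>
     (\<forall>v\<in>pverts G. out_degree (with_proj G) v \<le> d)}"

text \<open>Each element of the finite set \<open>V\<close> is kept independently with probability \<open>p\<close>.\<close>

definition bernoulli_sample :: "real \<Rightarrow> nat set \<Rightarrow> nat set pmf" where
  "bernoulli_sample p V =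
     map_pmf (\<lambda>f. {v \<in> V. f v}) (Pi_pmf V False (\<lambda>_. bernoulli_pmf p))"

text \<open>
  The sampled graph is observed only up to isomorphism, so estimators are the real functions
  that are invariant under isomorphism.
\<close>

definition estimators :: "(dgraph \<Rightarrow> real) set" where
  "estimators = {h. \<forall>G H. digraph_iso G H \<longrightarrow> h G = h H}"

definition mse :: "real \<Rightarrow> (dgraph \<Rightarrow> real) \<Rightarrow> dgraph \<Rightarrow> real" where
  "mse p h G = measure_pmf.expectation (bernoulli_sample p (verts G))
     (\<lambda>S. \<bar>h (G \<restriction> S) - real (cc G)\<bar>\<^sup>2)"

text \<open>
  The infimum and supremum are taken in \<open>ennreal\<close>, where they always exist. The
  number of vertices, the degree bound and \<open>p\<close> are fixed outside the infimum, so
  an estimator may depend on them.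
\<close>

definition minimax_risk :: "nat \<Rightarrow> nat \<Rightarrow> real \<Rightarrow> ennreal" where
  "minimax_risk N d p = (INF h\<in>estimators. SUP G\<in>forests N d. ennreal (mse p h G))"

text \<open>
  \<open>N = 1\<close> is degenerate: there is only the one-vertex forest, so the minimax risk
  is 0, whereas the rate is positive for \<open>p < 1\<close>. A lower bound on the risk by a
  multiple of the rate therefore needs \<open>2 \<le> N\<close>.
\<close>

definition rate :: "nat \<Rightarrow> nat \<Rightarrow> real \<Rightarrow> real" where
  "rate N d p = (let q = 1 - p in
     if p = 0 then (real N)\<^sup>2
     else min (max (real N * q / p\<^sup>2) (real N * q * real d / p)) ((real N)\<^sup>2))"

end

theory Submission
  imports Defs
begin

text \<open>
  Upper bound: a forest has \<open>|V| - |E|\<close> components, so the Horvitz--Thompson estimator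
  \<open>|V(S)| / p - |E(S)| / p^2\<close> is unbiased. In terms of the independent centred variables
  \<open>1[v \<in> S] / p - 1\<close>, of variance \<open>q / p\<close>, its error is a linear form with coefficients
  \<open>1 - deg v\<close> minus one product per edge, and the products of distinct edges are uncorrelated.
  The constant estimator 0 accounts for the truncation at \<open>N^2\<close>.

  Lower bound: split \<open>M (k + 1)\<close> of the \<open>N\<close> vertices into \<open>M\<close> blocks of \<open>k + 1\<close> vertices; block \<open>i\<close>
  carries a star with \<open>k\<close> leaves if \<open>i \<in> \<Theta>\<close> and no edge otherwise. A sample tells whether
  \<open>i \<in> \<Theta>\<close> only if it contains the centre and a leaf of block \<open>i\<close>. Under the prior which makes
  the block indicators conditionally independent with a uniformly distributed success
  probability, the posterior variance of \<open>|\<Theta>|\<close> given the status of \<open>a\<close> blocks has mean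
  \<open>(M - a) (M + 2) / (6 (a + 2))\<close>. By convexity in \<open>a\<close>, if each block is revealed with
  probability at most \<open>s\<close>, the Bayes risk is at least
  \<open>k^2 M (M + 2) (1 - s) / (6 (M s + 2))\<close>. Single edges (\<open>k = 1\<close>, \<open>s = p^2\<close>) give the first term of
  the rate, and stars of maximal size (\<open>s = p\<close>) the second.
\<close>

subsection \<open>Components of forests\<close>

text \<open>The new edge fuses the classes \<open>U\<close> and \<open>W\<close> of its two ends and
  leaves every other class as it was.\<close>

lemma card_classes_add_edge:
  fixes E :: "'a rel"
  assumes fin: "finite V" and uV: "u \<in> V" and vV: "v \<in> V" and sym: "sym E"
    and nuv: "(u, v) \<notin> E\<^sup>*"
  shows "card ((\<lambda>x. E\<^sup>* `` {x}) ` V)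
    = Suc (card ((\<lambda>x. (insert (u, v) (insert (v, u) E))\<^sup>* `` {x}) ` V))"
proof -
  define F where "F = insert (u, v) (insert (v, u) E)"
  define U where "U = E\<^sup>* `` {u}"
  define W where "W = E\<^sup>* `` {v}"
  have symE: "(y, x) \<in> E\<^sup>*" if "(x, y) \<in> E\<^sup>*" for x y
    using sym_rtrancl[OF sym] that by (auto dest: symD)
  \<comment> \<open>By symmetry the vertices that reach \<open>v\<close> are those of
    \<open>W\<close>, and likewise for \<open>u\<close> and \<open>U\<close>, so
    \<open>rtrancl_insert\<close> adds exactly the pairs between the two classes.\<close>
  have F1: "F\<^sup>* = E\<^sup>* \<union> U \<times> W \<union> W \<times> U"
  proof -
    have "(insert (v, u) E)\<^sup>* = E\<^sup>* \<union> W \<times> U"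
      unfolding rtrancl_insert U_def W_def using symE by auto
    then show ?thesis
      unfolding F_def rtrancl_insert[of u v] U_def W_def using symE nuv
      by (auto intro: rtrancl_trans)
  qed
  have UW: "U \<inter> W = {}"
    unfolding U_def W_def using nuv symE by (auto intro: rtrancl_trans)
  have clU: "E\<^sup>* `` {x} = U" if "x \<in> U" for x
    using that unfolding U_def using symE by (auto intro: rtrancl_trans)
  have clW: "E\<^sup>* `` {x} = W" if "x \<in> W" for x
    using that unfolding W_def using symE by (auto intro: rtrancl_trans)
  have uU: "u \<in> U" and vW: "v \<in> W" by (auto simp: U_def W_def)
  define R where "R = (\<lambda>x. E\<^sup>* `` {x}) ` (V - U - W)"
  have notR: "X \<notin> R" if "X \<inter> (U \<union> W) \<noteq> {}" for X
  proof
    assume "X \<in> R"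
    then obtain x where x: "x \<in> V - U - W" "X = E\<^sup>* `` {x}" by (auto simp: R_def)
    from that obtain y where "y \<in> U \<union> W" "(x, y) \<in> E\<^sup>*" using x by auto
    then have "x \<in> U \<union> W" unfolding U_def W_def using symE by (auto intro: rtrancl_trans)
    with x show False by auto
  qed
  have E2: "(\<lambda>x. E\<^sup>* `` {x}) ` V = insert U (insert W R)"
  proof -
    have "V = (V \<inter> U) \<union> (V \<inter> W) \<union> (V - U - W)" by auto
    then have "(\<lambda>x. E\<^sup>* `` {x}) ` V = (\<lambda>x. E\<^sup>* `` {x}) ` (V \<inter> U) \<union> (\<lambda>x. E\<^sup>* `` {x}) ` (V \<inter> W) \<union> R"
      unfolding R_def by (metis image_Un)
    moreover have "(\<lambda>x. E\<^sup>* `` {x}) ` (V \<inter> U) = {U}" using clU uU uV by auto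
    moreover have "(\<lambda>x. E\<^sup>* `` {x}) ` (V \<inter> W) = {W}" using clW vW vV by auto
    ultimately show ?thesis by auto
  qed
  have F2: "(\<lambda>x. F\<^sup>* `` {x}) ` V = insert (U \<union> W) R"
  proof -
    have in_UW: "F\<^sup>* `` {x} = U \<union> W" if "x \<in> U \<union> W" for x
      using that clU clW UW unfolding F1 by auto
    have out_UW: "F\<^sup>* `` {x} = E\<^sup>* `` {x}" if "x \<notin> U" "x \<notin> W" for x
      using that unfolding F1 by auto
    have "V = (V \<inter> (U \<union> W)) \<union> (V - U - W)" by auto
    then have "(\<lambda>x. F\<^sup>* `` {x}) ` V = (\<lambda>x. F\<^sup>* `` {x}) ` (V \<inter> (U \<union> W)) \<union> (\<lambda>x. F\<^sup>* `` {x}) ` (V - U - W)"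
      by (metis image_Un)
    moreover have "(\<lambda>x. F\<^sup>* `` {x}) ` (V \<inter> (U \<union> W)) = {U \<union> W}"
      using in_UW uU uV by blast
    moreover have "(\<lambda>x. F\<^sup>* `` {x}) ` (V - U - W) = R"
      unfolding R_def by (rule image_cong) (use out_UW in auto)
    ultimately show ?thesis by auto
  qed
  have finR: "finite R" unfolding R_def using fin by auto
  have "U \<noteq> W" using UW uU by auto
  moreover have "U \<notin> R" "W \<notin> R" "U \<union> W \<notin> R"
    using uU vW by (auto intro!: notR)
  ultimately have "card (insert U (insert W R)) = Suc (card (insert (U \<union> W) R))"
    using finR by simp
  then show ?thesis using E2 F2 unfolding F_def by simp
qed

text \<open>With symmetric arcs strong connectivity is plain reachability, and since arcs stay
  inside the vertex set, reachability in the graph agrees with the closure of the arc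
  relation.\<close>

lemma cc_pair_graph:
  assumes "pair_graph G"
  shows "cc (with_proj G) = card ((\<lambda>x. (parcs G)\<^sup>* `` {x}) ` pverts G)"
proof -
  interpret pair_graph G by fact
  have "cc (with_proj G) = card (scc_of ` pverts G)"
    unfolding cc_def card_sccs_verts[symmetric] sccs_verts_conv_scc_of by simp
  also have "scc_of ` pverts G = (\<lambda>x. (parcs G)\<^sup>* `` {x}) ` pverts G"
  proof (rule image_cong[OF refl])
    fix x assume x: "x \<in> pverts G"
    have *: "reachable (with_proj G) x y \<longleftrightarrow> (x, y) \<in> (parcs G)\<^sup>*" for y
    proof
      assume "(x, y) \<in> (parcs G)\<^sup>*"
      then have "y \<in> pverts G"
        using x by (induction rule: rtrancl_induct) (auto dest: in_arcsD2)
      with \<open>(x, y) \<in> _\<close> x show "reachable (with_proj G) x y"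
        unfolding reachable_def with_proj_simps
        by (intro rtrancl_consistent_rtrancl_on) (auto dest: in_arcsD2)
    qed (auto simp: reachable_def dest: rtrancl_on_rtranclI)
    then show "scc_of x = (parcs G)\<^sup>* `` {x}"
      unfolding scc_of_def using symmetric_reachable[OF sym_arcs] by auto
  qed
  finally show ?thesis .
qed

lemma pair_graph_iff:
  "pair_graph G \<longleftrightarrow> finite (pverts G) \<and> parcs G \<subseteq> pverts G \<times> pverts G \<and> sym (parcs G) \<and>
     (\<forall>u. (u, u) \<notin> parcs G)"
proof
  assume "pair_graph G"
  then interpret pair_graph G .
  show "finite (pverts G) \<and> parcs G \<subseteq> pverts G \<times> pverts G \<and> sym (parcs G) \<and> (\<forall>u. (u, u) \<notin> parcs G)"
    using in_arcsD1 in_arcsD2 arcs_symmetric no_loops' pair_finite_verts by (auto intro: symI dest: no_loops')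
next
  assume *: "finite (pverts G) \<and> parcs G \<subseteq> pverts G \<times> pverts G \<and> sym (parcs G) \<and> (\<forall>u. (u, u) \<notin> parcs G)"
  then have "finite (parcs G)" by (meson finite_SigmaI finite_subset)
  then show "pair_graph G" using *
    by unfold_locales (auto simp: symmetric_def)
qed

lemma cycle_with_proj_mono:
  assumes "pre_digraph.cycle (with_proj H) w" "pverts H \<subseteq> pverts G" "parcs H \<subseteq> parcs G"
  shows "pre_digraph.cycle (with_proj G) w"
  using assms unfolding pre_digraph.cycle_def pre_digraph.awalk_def
  by (auto simp: cas_with_proj_eq awalk_verts_with_proj_eq)

text \<open>Otherwise a simple path from \<open>u\<close> to \<open>v\<close> that avoids the edge
  would close up to a cycle through the arc \<open>(v, u)\<close>.\<close>

lemma forest_edge_is_bridge: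
  assumes G: "undirected_forest G" and uv: "(u, v) \<in> parcs G"
  shows "(u, v) \<notin> (parcs G - {(u, v), (v, u)})\<^sup>*"
proof
  assume *: "(u, v) \<in> (parcs G - {(u, v), (v, u)})\<^sup>*"
  from G have pg: "pair_graph G" and
    nocyc: "\<not> (\<exists>w. pre_digraph.cycle (with_proj G) w \<and> 3 \<le> length w)"
    by (auto simp: undirected_forest_def)
  interpret G: pair_graph G by fact
  define H where "H = G\<lparr>parcs := parcs G - {(u, v), (v, u)}\<rparr>"
  have H: "pair_graph H"
    using pg unfolding pair_graph_iff H_def by (auto simp: sym_def)
  interpret H: pair_graph H by fact
  have uvV: "u \<in> pverts G" "v \<in> pverts G" using uv by (auto dest: G.in_arcsD1 G.in_arcsD2)
  have "reachable (with_proj H) u v"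
    unfolding reachable_def with_proj_simps
    by (rule rtrancl_consistent_rtrancl_on) (use * uvV in \<open>auto simp: H_def dest: G.in_arcsD2\<close>)
  then obtain p where p: "H.apath u p v" by (auto simp: H.reachable_apath)
  have aw: "G.awalk u p v"
    using p unfolding H.apath_def H.awalk_def G.awalk_def by (auto simp: H_def)
  have dist: "distinct (pawalk_verts u p)" using p by (simp add: H.apath_def)
  have "u \<noteq> v" using uv by (auto dest: G.no_loops')
  \<comment> \<open>The only path with one arc is the deleted arc itself; hence the closed walk has
    length at least 3 and is excluded in a forest.\<close>
  have len: "2 \<le> length p"
  proof (rule ccontr)
    assume "\<not> 2 \<le> length p"
    then have "p = [] \<or> (\<exists>e. p = [e])" by (cases p) (auto simp: not_le Suc_le_eq less_Suc_eq length_Suc_conv)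
    then show False
    proof
      assume "p = []" then show False using p \<open>u \<noteq> v\<close> by (auto simp: H.apath_Nil_iff)
    next
      assume "\<exists>e. p = [e]"
      then obtain e where "p = [e]" ..
      then have "e = (u, v)" "e \<in> parcs H"
        using p by (auto simp: H.apath_def H.awalk_def prod_eq_iff)
      then show False by (auto simp: H_def)
    qed
  qed
  have vu: "(v, u) \<in> parcs G" using uv by (rule G.arcs_symmetric)
  have cl: "G.awalk u (p @ [(v, u)]) u"
    using aw vu uvV by (auto simp: G.awalk_simps)
  have "pawalk_verts u (p @ [(v, u)]) = pawalk_verts u p @ [u]"
    using aw vu by (subst G.awalk_verts_append[OF cl]) (auto dest: G.awalk_ends simp: G.awalk_simps)
  moreover obtain e q where "p = e # q" using len by (cases p) auto
  moreover have "fst e = u" using aw \<open>p = e # q\<close> by (auto simp: G.awalk_simps)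
  \<comment> \<open>A cycle must avoid repetitions only in the tail of its vertex list: the initial
    \<open>u\<close> drops out and the appended \<open>u\<close> takes its place.\<close>
  ultimately have "distinct (tl (pawalk_verts u (p @ [(v, u)])))"
    using dist by auto
  then have "G.cycle (p @ [(v, u)])" unfolding G.cycle_def using cl by auto
  with len nocyc show False by force
qed

text \<open>Deleting an edge removes two arcs and, because the edge is a bridge, creates one more
  component. Doubling the component and vertex counts matches the two arcs per edge without
  division.\<close>

lemma cc_forest:
  assumes "undirected_forest G"
  shows "2 * cc (with_proj G) + card (parcs G) = 2 * card (pverts G)"
  using assms
proof (induction "card (parcs G)" arbitrary: G rule: less_induct)
  case less
  then have pg: "pair_graph G" by (simp add: undirected_forest_def)
  interpret G: pair_graph G by fact
  show ?case
  proof (cases "parcs G = {}")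
    case True
    have "cc (with_proj G) = card ((\<lambda>x. {x}) ` pverts G)"
      unfolding cc_pair_graph[OF pg] True by simp
    also have "\<dots> = card (pverts G)" by (rule card_image) auto
    finally show ?thesis using True by simp
  next
    case False
    then obtain u v where uv: "(u, v) \<in> parcs G" by auto
    then have vu: "(v, u) \<in> parcs G" by (rule G.arcs_symmetric)
    have "u \<noteq> v" using uv by (auto dest: G.no_loops')
    define H where "H = G\<lparr>parcs := parcs G - {(u, v), (v, u)}\<rparr>"
    have H: "pair_graph H"
      using pg unfolding pair_graph_iff H_def by (auto simp: sym_def)
    have "undirected_forest H"
      using less.prems H cycle_with_proj_mono[of H _ G] unfolding undirected_forest_def
      by (auto simp: H_def)
    have cG: "card (parcs G) = card (parcs H) + 2"
    proof -
      have "parcs G = insert (u, v) (insert (v, u) (parcs H))" using uv vu by (auto simp: H_def)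
      moreover have "finite (parcs H)" "(u, v) \<notin> insert (v, u) (parcs H)" "(v, u) \<notin> parcs H"
        using \<open>u \<noteq> v\<close> by (auto simp: H_def)
      ultimately show ?thesis by simp
    qed
    have IH: "2 * cc (with_proj H) + card (parcs H) = 2 * card (pverts H)"
      using less.hyps[of H] cG \<open>undirected_forest H\<close> by simp
    have "cc (with_proj H) = Suc (cc (with_proj G))"
    proof -
      have "parcs G = insert (u, v) (insert (v, u) (parcs H))" using uv vu by (auto simp: H_def)
      moreover have "card ((\<lambda>x. (parcs H)\<^sup>* `` {x}) ` pverts G) =
        Suc (card ((\<lambda>x. (insert (u, v) (insert (v, u) (parcs H)))\<^sup>* `` {x}) ` pverts G))"
      proof (rule card_classes_add_edge)
        show "sym (parcs H)" using H by (simp add: pair_graph_iff)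
        show "(u, v) \<notin> (parcs H)\<^sup>*"
          using forest_edge_is_bridge[OF less.prems uv] by (simp add: H_def)
      qed (use uv in \<open>auto dest: G.in_arcsD1 G.in_arcsD2\<close>)
      ultimately show ?thesis
        unfolding cc_pair_graph[OF pg] cc_pair_graph[OF H] by (simp add: H_def)
    qed
    with IH cG show ?thesis by (simp add: H_def)
  qed
qed

subsection \<open>Bernoulli sampling\<close>

definition sample_weight :: "real \<Rightarrow> 'a set \<Rightarrow> 'a set \<Rightarrow> real" where
  "sample_weight p V S = p ^ card S * (1 - p) ^ card (V - S)"

text \<open>The expectation as a finite sum, so that linearity and interchange of sums need no
  integrability argument.\<close>

definition sample_mean :: "real \<Rightarrow> 'a set \<Rightarrow> ('a set \<Rightarrow> real) \<Rightarrow> real" where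
  "sample_mean p V F = (\<Sum>S\<in>Pow V. sample_weight p V S * F S)"

lemma expectation_bernoulli_sample:
  assumes V: "finite V" and p: "0 \<le> p" "p \<le> 1"
  shows "measure_pmf.expectation (bernoulli_sample p V) F = sample_mean p V F"
proof -
  let ?P = "Pi_pmf V False (\<lambda>_. bernoulli_pmf p)"
  let ?ind = "\<lambda>S v. v \<in> S"
  have "measure_pmf.expectation (bernoulli_sample p V) F = measure_pmf.expectation ?P (\<lambda>f. F {v \<in> V. f v})"
    unfolding bernoulli_sample_def by simp
  also have "\<dots> = (\<Sum>f\<in>?ind ` Pow V. F {v \<in> V. f v} * pmf ?P f)"
  proof (rule integral_measure_pmf_real)
    fix f assume f: "f \<in> set_pmf ?P"
    then have "f = ?ind {v \<in> V. f v}"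
      using set_Pi_pmf_subset[OF V, of False "\<lambda>_. bernoulli_pmf p"] by (auto simp: fun_eq_iff)
    then show "f \<in> ?ind ` Pow V" by blast
  qed (use V in simp)
  also have "\<dots> = (\<Sum>S\<in>Pow V. F {v \<in> V. v \<in> S} * pmf ?P (?ind S))"
    by (subst sum.reindex) (auto simp: inj_on_def fun_eq_iff)
  also have "\<dots> = (\<Sum>S\<in>Pow V. sample_weight p V S * F S)"
  proof (rule sum.cong[OF refl])
    fix S assume S: "S \<in> Pow V"
    have "pmf ?P (?ind S) = (\<Prod>v\<in>V. if v \<in> S then p else 1 - p)"
      using S p V by (subst pmf_Pi') (auto intro!: prod.cong)
    also have "\<dots> = sample_weight p V S"
      using S V by (simp add: prod.If_cases sample_weight_def Int_absorb1 Diff_eq)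
    moreover have "{v \<in> V. v \<in> S} = S" using S by auto
    ultimately show "F {v \<in> V. v \<in> S} * pmf ?P (?ind S) = sample_weight p V S * F S" by simp
  qed
  finally show ?thesis by (simp add: sample_mean_def)
qed

lemma sample_weight_nonneg: "0 \<le> p \<Longrightarrow> p \<le> 1 \<Longrightarrow> 0 \<le> sample_weight p V S"
  by (simp add: sample_weight_def)

lemma sample_mean_mono:
  assumes "0 \<le> p" "p \<le> 1" "\<And>S. S \<subseteq> V \<Longrightarrow> F S \<le> H S"
  shows "sample_mean p V F \<le> sample_mean p V H"
  unfolding sample_mean_def by (intro sum_mono mult_left_mono sample_weight_nonneg) (use assms in auto)

lemma sample_mean_cong:
  "(\<And>S. S \<subseteq> V \<Longrightarrow> F S = H S) \<Longrightarrow> sample_mean p V F = sample_mean p V H"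
  unfolding sample_mean_def by (intro sum.cong) auto

lemma sample_mean_cmult: "sample_mean p V (\<lambda>S. c * F S) = c * sample_mean p V F"
  by (simp add: sample_mean_def sum_distrib_left mult_ac)

lemma sample_mean_add: "sample_mean p V (\<lambda>S. F S + H S) = sample_mean p V F + sample_mean p V H"
  by (simp add: sample_mean_def sum.distrib distrib_left)

lemma sample_mean_sum: "sample_mean p V (\<lambda>S. \<Sum>i\<in>I. F i S) = (\<Sum>i\<in>I. sample_mean p V (F i))"
  unfolding sample_mean_def sum_distrib_left by (rule sum.swap)

text \<open>This is independence of the vertices: expanding the product on the right chooses for
  each vertex whether it is sampled, so the terms correspond to the samples.\<close>

lemma sample_mean_prod:
  assumes "finite V"
  shows "sample_mean p V (\<lambda>S. \<Prod>v\<in>V. if v \<in> S then f v else g v) = (\<Prod>v\<in>V. p * f v + (1 - p) * g v)"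
proof -
  have "sample_weight p V S * (\<Prod>v\<in>V. if v \<in> S then f v else g v)
     = (\<Prod>v\<in>S. p * f v) * (\<Prod>v\<in>V - S. (1 - p) * g v)" if "S \<in> Pow V" for S
    using that assms
    by (simp add: prod.If_cases sample_weight_def Int_absorb1 Diff_eq prod.distrib)
  then show ?thesis
    unfolding sample_mean_def by (simp add: prod_add[OF assms])
qed

lemma sample_mean_const:
  assumes "finite V"
  shows "sample_mean p V (\<lambda>_. c) = c"
  using sample_mean_prod[OF assms, of p "\<lambda>_. 1" "\<lambda>_. 1"] sample_mean_cmult[of p V c "\<lambda>_. 1"] by simp

lemma sample_mean_subset:
  assumes "finite V" "T \<subseteq> V"
  shows "sample_mean p V (\<lambda>S. of_bool (T \<subseteq> S)) = p ^ card T"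
proof -
  have "sample_mean p V (\<lambda>S. of_bool (T \<subseteq> S))
    = sample_mean p V (\<lambda>S. \<Prod>v\<in>V. if v \<in> S then 1 else of_bool (v \<notin> T))"
  proof (rule sample_mean_cong)
    fix S assume "S \<subseteq> V"
    show "of_bool (T \<subseteq> S) = (\<Prod>v\<in>V. if v \<in> S then 1 else of_bool (v \<notin> T) :: real)"
    proof (cases "T \<subseteq> S")
      case True
      then have "(\<Prod>v\<in>V. if v \<in> S then 1 else of_bool (v \<notin> T) :: real) = 1"
        by (intro prod.neutral) auto
      with True show ?thesis by simp
    next
      case False
      then obtain v where "v \<in> T" "v \<notin> S" by auto
      then show ?thesis using assms False by (auto intro!: prod_zero[symmetric] bexI[of _ v])
    qed
  qed
  also have "\<dots> = (\<Prod>v\<in>V. if v \<in> T then p else 1)"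
    unfolding sample_mean_prod[OF assms(1)] by (rule prod.cong) auto
  also have "\<dots> = p ^ card T"
    using assms by (simp add: prod.If_cases Int_absorb2 Int_absorb1)
  finally show ?thesis .
qed

section \<open>Moments of the centred sampling variables\<close>

definition sampling_noise :: "real \<Rightarrow> 'a set \<Rightarrow> 'a \<Rightarrow> real" where
  "sampling_noise p S v = (if v \<in> S then 1 / p - 1 else - 1)"

text \<open>The exponent function \<open>n\<close> encodes an arbitrary monomial. For nonzero
  \<open>p\<close> a vertex of exponent 0 contributes 1, exponent 1 contributes 0 and exponent 2
  contributes \<open>(1 - p) / p\<close>.\<close>

lemma sample_mean_sampling_noise_monomial:
  assumes "finite V"
  shows "sample_mean p V (\<lambda>S. \<Prod>v\<in>V. sampling_noise p S v ^ n v)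
    = (\<Prod>v\<in>V. p * (1 / p - 1) ^ n v + (1 - p) * (- 1) ^ n v)"
proof -
  have "sample_mean p V (\<lambda>S. \<Prod>v\<in>V. sampling_noise p S v ^ n v)
    = sample_mean p V (\<lambda>S. \<Prod>v\<in>V. if v \<in> S then (1 / p - 1) ^ n v else (- 1) ^ n v)"
    unfolding sampling_noise_def by (intro sample_mean_cong prod.cong) auto
  then show ?thesis by (simp add: sample_mean_prod[OF assms])
qed

lemma prod_power_of_bool_eq:
  fixes f :: "'a \<Rightarrow> real"
  assumes "finite V" "u \<in> V"
  shows "(\<Prod>v\<in>V. f v ^ of_bool (v = u)) = f u"
proof -
  have "(\<Prod>v\<in>V. f v ^ of_bool (v = u)) = (\<Prod>v\<in>V. if v = u then f v else 1)"
    by (rule prod.cong) auto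
  then show ?thesis using assms by (simp add: prod.delta)
qed

lemma sampling_noise_variance:
  fixes p :: real
  assumes "p \<noteq> 0"
  shows "p * (1 / p - 1)\<^sup>2 + (1 - p) * (- 1)\<^sup>2 = (1 - p) / p"
  proof -
  have "p * (1 / p - 1)\<^sup>2 + (1 - p) * (- 1)\<^sup>2 = (p * (1 / p)) * (1 / p) - 2 * (p * (1 / p)) + p + (1 - p)"
    by (simp add: power2_eq_square algebra_simps)
  also have "\<dots> = 1 / p - 1" using assms by simp
  also have "\<dots> = (1 - p) / p" using assms by (simp add: diff_divide_distrib)
  finally show ?thesis .
qed

lemma sample_mean_noise_noise:
  assumes V: "finite V" "u \<in> V" "v \<in> V" and p: "p \<noteq> 0"
  shows "sample_mean p V (\<lambda>S. sampling_noise p S u * sampling_noise p S v) = (if u = v then (1 - p) / p else 0)"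
proof -
  define n where "n w = (of_bool (w = u) + of_bool (w = v) :: nat)" for w
  have "sample_mean p V (\<lambda>S. sampling_noise p S u * sampling_noise p S v) = sample_mean p V (\<lambda>S. \<Prod>w\<in>V. sampling_noise p S w ^ n w)"
    unfolding n_def power_add prod.distrib using V by (simp add: prod_power_of_bool_eq)
  also have "\<dots> = (\<Prod>w\<in>V. p * (1 / p - 1) ^ n w + (1 - p) * (- 1) ^ n w)"
    by (rule sample_mean_sampling_noise_monomial[OF V(1)])
  also have "\<dots> = (if u = v then (1 - p) / p else 0)"
  proof (cases "u = v")
    case True
    have "(\<Prod>w\<in>V. p * (1 / p - 1) ^ n w + (1 - p) * (- 1) ^ n w)
      = (\<Prod>w\<in>V. if w = u then (1 - p) / p else 1)"
      using True sampling_noise_variance[OF p] by (intro prod.cong) (auto simp: n_def numeral_2_eq_2)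
    then show ?thesis using True V by (simp add: prod.delta)
  next
    case False
    have "\<exists>w\<in>V. p * (1 / p - 1) ^ n w + (1 - p) * (- 1) ^ n w = 0"
      using False V p by (intro bexI[of _ u]) (auto simp: n_def field_simps)
    with False V show ?thesis by (simp add: prod_zero)
  qed
  finally show ?thesis .
qed

text \<open>If the two edges differ, some vertex occurs with exponent exactly 1 and its factor
  vanishes. Listing each edge in increasing order lets equality of edges be equality of
  pairs.\<close>

lemma sample_mean_sampling_noise_edges:
  fixes u v x y :: "'a :: linorder"
  assumes V: "finite V" "u \<in> V" "v \<in> V" "x \<in> V" "y \<in> V" and p: "p \<noteq> 0"
    and ord: "u < v" "x < y"
  shows "sample_mean p V (\<lambda>S. (sampling_noise p S u * sampling_noise p S v) * (sampling_noise p S x * sampling_noise p S y))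
    = (if u = x \<and> v = y then ((1 - p) / p)\<^sup>2 else 0)"
proof -
  define n where "n w = (of_bool (w = u) + of_bool (w = v) + (of_bool (w = x) + of_bool (w = y)) :: nat)" for w
  define f where "f w = p * (1 / p - 1) ^ n w + (1 - p) * (- 1) ^ n w" for w
  have "sample_mean p V (\<lambda>S. (sampling_noise p S u * sampling_noise p S v) * (sampling_noise p S x * sampling_noise p S y))
     = sample_mean p V (\<lambda>S. \<Prod>w\<in>V. sampling_noise p S w ^ n w)"
    unfolding n_def power_add prod.distrib using V by (simp add: prod_power_of_bool_eq)
  also have "\<dots> = (\<Prod>w\<in>V. f w)"
    unfolding f_def by (rule sample_mean_sampling_noise_monomial[OF V(1)])
  also have "\<dots> = (if u = x \<and> v = y then ((1 - p) / p)\<^sup>2 else 0)"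
  proof (cases "u = x \<and> v = y")
    case True
    have "(\<Prod>w\<in>V. f w) = (\<Prod>w\<in>V. ((1 - p) / p) ^ of_bool (w = u) * ((1 - p) / p) ^ of_bool (w = v))"
      using True ord sampling_noise_variance[OF p] unfolding f_def
      by (intro prod.cong) (auto simp: n_def numeral_2_eq_2)
    also have "\<dots> = ((1 - p) / p)\<^sup>2"
      unfolding prod.distrib using V by (simp add: prod_power_of_bool_eq power2_eq_square)
    finally show ?thesis using True by simp
  next
    case False
    then have "u \<notin> {v, x, y} \<or> v \<notin> {u, x, y}" using ord by auto
    then obtain w where w: "w \<in> V" "n w = 1" using V by (auto simp: n_def)
    have "f w = 0" using w(2) p by (simp add: f_def field_simps)
    with w False V show ?thesis by (auto simp: prod_zero)
  qed
  finally show ?thesis .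
qed

subsection \<open>The unbiased estimator\<close>

lemma mse_eq_sample_mean:
  assumes "finite (verts G)" "0 \<le> p" "p \<le> 1"
  shows "mse p h G = sample_mean p (verts G) (\<lambda>S. (h (G \<restriction> S) - real (cc G))\<^sup>2)"
  unfolding mse_def by (simp add: expectation_bernoulli_sample[OF assms])

text \<open>An edge is seen with probability \<open>p\<^sup>2\<close> and counts as two arcs, which
  explains the denominator of the second term.\<close>

definition horvitz_thompson :: "real \<Rightarrow> dgraph \<Rightarrow> real" where
  "horvitz_thompson p G = real (card (verts G)) / p - real (card (arcs G)) / (2 * p\<^sup>2)"

lemma horvitz_thompson_in_estimators: "horvitz_thompson p \<in> estimators"
proof -
  have "horvitz_thompson p G = horvitz_thompson p H" if "digraph_iso G H" for G H
  proof -
    from that obtain f where f: "pre_digraph.digraph_isomorphism G f" and H: "H = app_iso f G"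
      by (auto simp: digraph_iso_def)
    then have "card (verts H) = card (verts G)" "card (arcs H) = card (arcs G)"
      by (auto simp: verts_app_iso arcs_app_iso pre_digraph.digraph_isomorphism_def card_image)
    then show ?thesis by (simp add: horvitz_thompson_def)
  qed
  then show ?thesis by (auto simp: estimators_def)
qed

text \<open>One orientation per edge: the two opposite arcs of an edge carry the same product of
  noises and would be correlated.\<close>

definition up_arcs :: "('a::linorder \<times> 'a) set \<Rightarrow> ('a \<times> 'a) set" where
  "up_arcs E = {(u, v). (u, v) \<in> E \<and> u < v}"

lemma sum_symmetric_arcs:
  fixes f :: "'a::linorder \<times> 'a \<Rightarrow> real"
  assumes "finite E" "sym E" "\<And>u. (u, u) \<notin> E" "\<And>u v. f (u, v) = f (v, u)"
  shows "(\<Sum>e\<in>E. f e) = 2 * (\<Sum>e\<in>up_arcs E. f e)"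
proof -
  have E: "E = up_arcs E \<union> prod.swap ` up_arcs E"
  proof (intro set_eqI iffI)
    fix e assume e: "e \<in> E"
    obtain u v where uv: "e = (u, v)" by force
    with e assms(3) have "u \<noteq> v" by auto
    then have "u < v \<or> v < u" by auto
    moreover have "(v, u) \<in> E" using e uv assms(2) by (auto dest: symD)
    ultimately show "e \<in> up_arcs E \<union> prod.swap ` up_arcs E"
      using e uv by (force simp: up_arcs_def image_iff)
  qed (use assms(2) in \<open>auto simp: up_arcs_def dest: symD\<close>)
  have fin: "finite (up_arcs E)" using assms(1) by (rule finite_subset[rotated]) (auto simp: up_arcs_def)
  have "(\<Sum>e\<in>E. f e) = (\<Sum>e\<in>up_arcs E. f e) + (\<Sum>e\<in>prod.swap ` up_arcs E. f e)"
    by (subst E, rule sum.union_disjoint) (use fin in \<open>auto simp: up_arcs_def\<close>)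
  also have "(\<Sum>e\<in>prod.swap ` up_arcs E. f e) = (\<Sum>e\<in>up_arcs E. f e)"
    using assms(4) by (subst sum.reindex) (auto intro!: sum.cong)
  finally show ?thesis by simp
qed

lemma sum_sym_swap:
  assumes "sym E"
  shows "(\<Sum>e\<in>E. f (snd e)) = (\<Sum>e\<in>E. f (fst e))"
  by (rule sum.reindex_bij_witness[of _ prod.swap prod.swap]) (use assms in \<open>auto dest: symD\<close>)

lemma sum_fst_by_degree:
  fixes f :: "'a \<Rightarrow> real"
  assumes "finite V" "E \<subseteq> V \<times> V"
  shows "(\<Sum>e\<in>E. f (fst e)) = (\<Sum>v\<in>V. real (card {e \<in> E. fst e = v}) * f v)"
proof -
  have "finite E" using assms finite_subset by blast
  then have "(\<Sum>e\<in>E. f (fst e)) = (\<Sum>v\<in>V. \<Sum>e\<in>{e \<in> E. fst e = v}. f (fst e))"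
    by (intro sum.group[symmetric]) (use assms in auto)
  then show ?thesis by simp
qed

text \<open>Each inverse-probability weighted indicator is the noise plus 1. Expanding the product
  over an edge gives a quadratic term, linear terms that add up to degrees, and a constant; the
  constants amount to vertices minus edges, which is the number of components.\<close>

lemma horvitz_thompson_error:
  assumes F: "undirected_forest G" and p: "p \<noteq> 0" and S: "S \<subseteq> pverts G"
  shows "horvitz_thompson p (with_proj G \<restriction> S) - real (cc (with_proj G))
    = (\<Sum>v\<in>pverts G. (1 - real (out_degree (with_proj G) v)) * sampling_noise p S v)
      - (\<Sum>e\<in>up_arcs (parcs G). sampling_noise p S (fst e) * sampling_noise p S (snd e))"
proof -
  define V where "V = pverts G"
  define E where "E = parcs G"
  define d where "d v = real (out_degree (with_proj G) v)" for v
  have G: "finite V" "E \<subseteq> V \<times> V" "sym E" "\<And>u. (u, u) \<notin> E"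
    using F unfolding undirected_forest_def pair_graph_iff V_def E_def by auto
  then have fE: "finite E" using finite_subset by blast
  have d: "d v = real (card {e \<in> E. fst e = v})" for v
    by (simp add: d_def out_degree_def out_arcs_def E_def)
  let ?x = "sampling_noise p S"
  have b: "of_bool (v \<in> S) / p = ?x v + 1" for v by (simp add: sampling_noise_def)
  have "real (card S) = (\<Sum>v\<in>V. of_bool (v \<in> S))"
    using S G(1) by (simp add: V_def Int_absorb1)
  then have verts: "real (card S) / p = (\<Sum>v\<in>V. ?x v) + real (card V)"
    by (simp add: sum_divide_distrib b sum.distrib)
  have "real (card {e \<in> E. fst e \<in> S \<and> snd e \<in> S}) / p\<^sup>2
      = (\<Sum>e\<in>E. (of_bool (fst e \<in> S) / p) * (of_bool (snd e \<in> S) / p))"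
  proof -
    have "real (card {e \<in> E. fst e \<in> S \<and> snd e \<in> S}) = (\<Sum>e\<in>E. of_bool (fst e \<in> S) * of_bool (snd e \<in> S))"
      using fE by (simp add: of_bool_conj[symmetric] Int_def del: of_bool_conj)
    then show ?thesis by (simp add: sum_divide_distrib power2_eq_square)
  qed
  also have "\<dots> = (\<Sum>e\<in>E. ?x (fst e) * ?x (snd e)) + (\<Sum>e\<in>E. ?x (fst e)) + (\<Sum>e\<in>E. ?x (snd e)) + real (card E)"
    unfolding b by (simp add: sum.distrib algebra_simps)
  also have "\<dots> = 2 * (\<Sum>e\<in>up_arcs E. ?x (fst e) * ?x (snd e)) + 2 * (\<Sum>v\<in>V. d v * ?x v) + real (card E)"
    unfolding sum_sym_swap[OF G(3)] sum_fst_by_degree[OF G(1,2)] d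
    by (subst sum_symmetric_arcs[OF fE G(3,4)]) (auto simp: mult.commute)
  finally have arcs: "real (card {e \<in> E. fst e \<in> S \<and> snd e \<in> S}) / (2 * p\<^sup>2)
    = (\<Sum>e\<in>up_arcs E. ?x (fst e) * ?x (snd e)) + (\<Sum>v\<in>V. d v * ?x v) + real (card E) / 2"
    by simp
  have cc: "real (cc (with_proj G)) = real (card V) - real (card E) / 2"
    using cc_forest[OF F] by (simp add: V_def E_def)
  show ?thesis
    using verts arcs cc unfolding horvitz_thompson_def
    by (simp add: V_def[symmetric] E_def[symmetric] d_def[symmetric] left_diff_distrib sum_subtractf)
qed

lemma sum_out_degree:
  assumes "pair_graph G"
  shows "(\<Sum>v\<in>pverts G. out_degree (with_proj G) v) = card (parcs G)"
proof -
  have G: "finite (pverts G)" "parcs G \<subseteq> pverts G \<times> pverts G"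
    using assms by (auto simp: pair_graph_iff)
  have "real (card (parcs G)) = real (\<Sum>v\<in>pverts G. out_degree (with_proj G) v)"
    using sum_fst_by_degree[OF G, of "\<lambda>_. 1"] by (simp add: out_degree_def out_arcs_def)
  then show ?thesis by linarith
qed

lemma square_sum_sum:
  fixes f :: "'a \<Rightarrow> real"
  shows "(\<Sum>i\<in>I. f i)\<^sup>2 = (\<Sum>i\<in>I. \<Sum>j\<in>I. f i * f j)"
  by (simp add: power2_eq_square sum_product)

text \<open>The linear part of the error has variance of order \<open>N d (1 - p) / p\<close>, the
  quadratic part at most of order \<open>N (1 - p) / p\<^sup>2\<close>.\<close>

lemma horvitz_thompson_mse:
  assumes G: "G \<in> forests N d" and d: "1 \<le> d" and p: "0 < p" "p \<le> 1"
  shows "mse p (horvitz_thompson p) G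
    \<le> 8 * max (real N * (1 - p) / p\<^sup>2) (real N * (1 - p) * real d / p)"
proof -
  from G obtain H where H: "undirected_forest H" "card (pverts H) = N" "G = with_proj H"
    and deg: "\<And>v. v \<in> pverts H \<Longrightarrow> out_degree (with_proj H) v \<le> d"
    by (auto simp: forests_def)
  define V where "V = pverts H"
  define E where "E = up_arcs (parcs H)"
  define \<tau> where "\<tau> = (1 - p) / p"
  define a where "a v = 1 - real (out_degree (with_proj H) v)" for v
  have pg: "pair_graph H" using H(1) by (simp add: undirected_forest_def)
  then have fV: "finite V" and sub: "parcs H \<subseteq> V \<times> V" and sy: "sym (parcs H)" and irr: "\<And>u. (u, u) \<notin> parcs H"
    by (auto simp: pair_graph_iff V_def)
  have fA: "finite (parcs H)" using fV sub finite_subset by blast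
  have \<tau>0: "0 \<le> \<tau>" using p by (simp add: \<tau>_def)
  have arcs2: "card (parcs H) \<le> 2 * N" using cc_forest[OF H(1)] H(2) by simp
  have cE: "real (card E) \<le> real N"
    using sum_symmetric_arcs[OF fA sy irr, of "\<lambda>_. 1"] arcs2 by (simp add: E_def)
  let ?L = "\<lambda>S. \<Sum>v\<in>V. a v * sampling_noise p S v"
  let ?Q = "\<lambda>S. \<Sum>e\<in>E. sampling_noise p S (fst e) * sampling_noise p S (snd e)"
  have p0: "p \<noteq> 0" using p by simp
  have "mse p (horvitz_thompson p) G
    = sample_mean p V (\<lambda>S. (horvitz_thompson p (with_proj H \<restriction> S) - real (cc (with_proj H)))\<^sup>2)"
    unfolding H(3) using mse_eq_sample_mean[of "with_proj H" p] p fV by (simp add: V_def)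
  also have "\<dots> = sample_mean p V (\<lambda>S. (?L S - ?Q S)\<^sup>2)"
    by (rule sample_mean_cong) (use horvitz_thompson_error[OF H(1) p0] in \<open>simp add: V_def a_def E_def\<close>)
  \<comment> \<open>Correlations between the linear and the quadratic part are avoided at the price
    of a factor 2.\<close>
  also have "\<dots> \<le> sample_mean p V (\<lambda>S. 2 * (?L S)\<^sup>2 + 2 * (?Q S)\<^sup>2)"
  proof (rule sample_mean_mono)
    fix S
    have "0 \<le> (?L S + ?Q S)\<^sup>2" by simp
    then show "(?L S - ?Q S)\<^sup>2 \<le> 2 * (?L S)\<^sup>2 + 2 * (?Q S)\<^sup>2"
      unfolding power2_sum power2_diff by linarith
  qed (use p in auto)
  also have "\<dots> = 2 * sample_mean p V (\<lambda>S. (?L S)\<^sup>2) + 2 * sample_mean p V (\<lambda>S. (?Q S)\<^sup>2)"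
    by (simp add: sample_mean_add sample_mean_cmult)
  also have "sample_mean p V (\<lambda>S. (?L S)\<^sup>2) = (\<Sum>v\<in>V. (a v)\<^sup>2 * \<tau>)"
  proof -
    have "sample_mean p V (\<lambda>S. (?L S)\<^sup>2)
      = (\<Sum>u\<in>V. \<Sum>v\<in>V. sample_mean p V (\<lambda>S. (a u * a v) * (sampling_noise p S u * sampling_noise p S v)))"
      unfolding square_sum_sum sample_mean_sum by (simp add: mult_ac)
    also have "\<dots> = (\<Sum>u\<in>V. \<Sum>v\<in>V. if u = v then a u * a v * \<tau> else 0)"
      unfolding sample_mean_cmult
      by (intro sum.cong refl) (simp add: sample_mean_noise_noise fV p0 \<tau>_def)
    finally show ?thesis using fV by (simp add: power2_eq_square)
  qed
  also have "sample_mean p V (\<lambda>S. (?Q S)\<^sup>2) = real (card E) * \<tau>\<^sup>2"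
  proof -
    have fE: "finite E" using fA by (rule finite_subset[rotated]) (auto simp: E_def up_arcs_def)
    have "sample_mean p V (\<lambda>S. (?Q S)\<^sup>2) = (\<Sum>e\<in>E. \<Sum>e'\<in>E. if e = e' then \<tau>\<^sup>2 else 0)"
      unfolding square_sum_sum sample_mean_sum
    proof (intro sum.cong refl)
      fix e e' assume "e \<in> E" "e' \<in> E"
      then have "fst e \<in> V" "snd e \<in> V" "fst e' \<in> V" "snd e' \<in> V" "fst e < snd e" "fst e' < snd e'"
        using sub by (auto simp: E_def up_arcs_def)
      then show "sample_mean p V (\<lambda>S. sampling_noise p S (fst e) * sampling_noise p S (snd e) * (sampling_noise p S (fst e') * sampling_noise p S (snd e')))
        = (if e = e' then \<tau>\<^sup>2 else 0)"
        by (simp add: sample_mean_sampling_noise_edges fV p0 \<tau>_def prod_eq_iff)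
    qed
    then show ?thesis using fE by simp
  qed
  \<comment> \<open>A vertex of degree \<open>k\<close> has squared coefficient at most
    \<open>1 + d k\<close>; the degrees sum to the number of arcs, which is at most
    \<open>2 N\<close>.\<close>
  also have "(\<Sum>v\<in>V. (a v)\<^sup>2 * \<tau>) \<le> 3 * real N * real d * \<tau>"
  proof -
    have "(a v)\<^sup>2 \<le> 1 + real d * real (out_degree (with_proj H) v)" if "v \<in> V" for v
    proof -
      let ?k = "real (out_degree (with_proj H) v)"
      have "?k \<le> real d" using deg that by (simp add: V_def)
      then have "?k * ?k \<le> real d * ?k" by (intro mult_right_mono) auto
      moreover have "(a v)\<^sup>2 = 1 - 2 * ?k + ?k * ?k"
        by (simp add: a_def power2_eq_square algebra_simps)
      ultimately show ?thesis by linarith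
    qed
    then have "(\<Sum>v\<in>V. (a v)\<^sup>2) \<le> (\<Sum>v\<in>V. 1 + real d * real (out_degree (with_proj H) v))"
      by (rule sum_mono)
    also have "\<dots> = real N + real d * real (card (parcs H))"
      using sum_out_degree[OF pg] H(2)
      by (simp add: sum.distrib sum_distrib_left[symmetric] V_def of_nat_sum[symmetric] del: of_nat_sum)
    also have "\<dots> \<le> real N * real d + real d * (2 * real N)"
      using d arcs2 by (intro add_mono mult_left_mono) (auto simp: mult_le_cancel_left1)
    finally have "(\<Sum>v\<in>V. (a v)\<^sup>2) \<le> 3 * real N * real d" by (simp add: mult_ac)
    then show ?thesis
      unfolding sum_distrib_right[symmetric] using \<tau>0 by (rule mult_right_mono)
  qed
  also have "real (card E) * \<tau>\<^sup>2 \<le> real N * ((1 - p) / p\<^sup>2)"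
  proof (rule mult_mono[OF cE])
    have "(1 - p) * (1 - p) \<le> 1 - p" using p by (simp add: mult_left_le)
    then show "\<tau>\<^sup>2 \<le> (1 - p) / p\<^sup>2"
      unfolding \<tau>_def power_divide by (intro divide_right_mono) (auto simp: power2_eq_square)
  qed auto
  also have "2 * (3 * real N * real d * \<tau>) + 2 * (real N * ((1 - p) / p\<^sup>2))
    = 6 * (real N * (1 - p) * real d / p) + 2 * (real N * (1 - p) / p\<^sup>2)"
    by (simp add: \<tau>_def)
  also have "\<dots> \<le> 8 * max (real N * (1 - p) / p\<^sup>2) (real N * (1 - p) * real d / p)"
  proof -
    have "6 * y + 2 * x \<le> 8 * max x y" for x y :: real by linarith
    then show ?thesis .
  qed
  finally show ?thesis by simp
qed

section \<open>The trivial estimator and the upper bound\<close>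

lemma zero_estimator_mse:
  assumes G: "G \<in> forests N d" and p: "0 \<le> p" "p \<le> 1"
  shows "mse p (\<lambda>_. 0) G \<le> (real N)\<^sup>2"
proof -
  from G obtain H where H: "undirected_forest H" "card (pverts H) = N" "G = with_proj H"
    by (auto simp: forests_def)
  then have fin: "finite (verts G)" by (simp add: undirected_forest_def pair_graph_iff)
  have "cc G \<le> N" using cc_forest[OF H(1)] H by simp
  then show ?thesis
    by (simp add: mse_eq_sample_mean[OF fin p] sample_mean_const[OF fin] power_mono)
qed

lemma minimax_risk_le:
  assumes "\<And>G. G \<in> forests N d \<Longrightarrow> mse p h G \<le> R" "h \<in> estimators"
  shows "minimax_risk N d p \<le> ennreal R"
  unfolding minimax_risk_def
  by (rule INF_lower2[OF assms(2)], rule SUP_least) (use assms(1) in \<open>simp add: ennreal_leI\<close>)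

lemma minimax_risk_upper:
  assumes d: "1 \<le> d" and p: "0 \<le> p" "p \<le> 1"
  shows "minimax_risk N d p \<le> ennreal (8 * rate N d p)"
proof -
  let ?m = "max (real N * (1 - p) / p\<^sup>2) (real N * (1 - p) * real d / p)"
  have zero: "minimax_risk N d p \<le> ennreal ((real N)\<^sup>2)"
    by (rule minimax_risk_le[OF zero_estimator_mse]) (use p in \<open>auto simp: estimators_def\<close>)
  show ?thesis
  proof (cases "p = 0 \<or> (real N)\<^sup>2 \<le> ?m")
    case True
    then have "rate N d p = (real N)\<^sup>2" by (auto simp: rate_def Let_def)
    then have "(real N)\<^sup>2 \<le> 8 * rate N d p" by simp
    with zero show ?thesis using ennreal_leI order_trans by blast
  next
    case False
    then have "rate N d p = ?m" by (auto simp: rate_def Let_def min_def)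
    then show ?thesis
      using minimax_risk_le[OF horvitz_thompson_mse[OF _ d] horvitz_thompson_in_estimators] False p
      by auto
  qed
qed

subsection \<open>An exchangeable prior\<close>

text \<open>
  The Beta integral \<open>\<integral> t^x (1 - t)^(a - x) dt\<close> over \<open>[0, 1]\<close>: the prior probability that a given
  set of \<open>x\<close> among \<open>a\<close> indicators is the set of ones.
\<close>
definition prior_weight :: "nat \<Rightarrow> nat \<Rightarrow> real" where
  "prior_weight a x = fact x * fact (a - x) / fact (Suc a)"

lemma prior_weight_nonneg: "0 \<le> prior_weight a x" by (simp add: prior_weight_def)

text \<open>The ratio is Laplace's rule of succession: after \<open>x\<close> ones among
  \<open>a\<close> indicators the next one is a one with probability
  \<open>(x + 1) / (a + 2)\<close>.\<close>

lemma prior_weight_Suc_Suc: "prior_weight (Suc a) (Suc x) = prior_weight a x * (real x + 1) / (real a + 2)"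
proof -
  have "fact (Suc (Suc a)) = (real a + 2) * (fact (Suc a) :: real)"
    by (simp add: algebra_simps)
  then show ?thesis by (simp add: prior_weight_def algebra_simps del: fact_Suc) (simp add: algebra_simps)
qed

lemma prior_weight_Suc:
  assumes "x \<le> a"
  shows "prior_weight (Suc a) x = prior_weight a x * (real a - real x + 1) / (real a + 2)"
proof -
  obtain k where a: "a = x + k" using assms by (auto simp: le_iff_add)
  have "Suc a - x = Suc k" "a - x = k" by (auto simp: a)
  then have "prior_weight (Suc a) x = fact x * ((real k + 1) * fact k) / ((real a + 2) * fact (Suc a))"
    and "prior_weight a x = fact x * fact k / fact (Suc a)"
    unfolding prior_weight_def by (simp_all add: algebra_simps)
  then show ?thesis by (simp add: a mult_ac)
qed

lemma prior_weight_split: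
  assumes "x \<le> a"
  shows "prior_weight (Suc a) x + prior_weight (Suc a) (Suc x) = prior_weight a x"
proof -
  have "prior_weight (Suc a) x + prior_weight (Suc a) (Suc x) = prior_weight a x * (real a + 2) / (real a + 2)"
    unfolding prior_weight_Suc[OF assms] prior_weight_Suc_Suc add_divide_distrib[symmetric] by (simp add: algebra_simps)
  then show ?thesis by simp
qed

text \<open>The induction step for the second moment. The reciprocals of \<open>a + 2\<close>,
  \<open>a + 3\<close>, \<open>a + 4\<close> become variables \<open>r\<close>, \<open>s\<close>,
  \<open>t\<close>, so that only a polynomial identity modulo three relations remains.\<close>

lemma second_moment_identity:
  fixes A X m P r s t :: real
  assumes "(A + 2) * r = 1" "(A + 3) * s = 1" "(A + 4) * t = 1"
  shows "P * (A - X + 1) * r * (m * (X + 1) * s + m * (m - 1) * (X + 1) * (X + 2) * (s * t))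
     + (P * (X + 1) * r * (m * (X + 2) * s + m * (m - 1) * (X + 2) * (X + 3) * (s * t))
     + 2 * (P * (X + 1) * r * (m * (X + 2) * s)) + P * (X + 1) * r)
   = P * ((m + 1) * (X + 1) * r + (m + 1) * m * (X + 1) * (X + 2) * (r * s))"
  using assms by algebra

text \<open>Second moment minus squared mean of the number of ones among \<open>m\<close> unseen
  indicators, that is, the beta-binomial variance, with the same treatment of reciprocals.\<close>

lemma variance_identity:
  fixes A X m r s :: real
  assumes "(A + 2) * r = 1" "(A + 3) * s = 1"
  shows "m * (X + 1) * r + m * (m - 1) * (X + 1) * (X + 2) * (r * s) - (m * (X + 1) * r)\<^sup>2
    = (X + 1) * (A - X + 1) * (r * s) * (m * (m + A + 2) * r)"
  using assms by algebra

section \<open>Sums over subsets and posterior moments\<close>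

lemma sum_Pow_insert:
  assumes "finite D" "i \<notin> D"
  shows "(\<Sum>C\<in>Pow (insert i D). F C) = (\<Sum>C\<in>Pow D. F C + F (insert i C))"
proof -
  have "(\<Sum>C\<in>Pow (insert i D). F C) = (\<Sum>C\<in>Pow D. F C) + (\<Sum>C\<in>insert i ` Pow D. F C)"
    unfolding Pow_insert by (rule sum.union_disjoint) (use assms in auto)
  also have "(\<Sum>C\<in>insert i ` Pow D. F C) = (\<Sum>C\<in>Pow D. F (insert i C))"
  proof (subst sum.reindex)
    show "inj_on (insert i) (Pow D)"
      using assms(2) by (intro inj_onI) (metis PowD insert_ident subsetD)
  qed simp
  finally show ?thesis by (simp add: sum.distrib)
qed

lemma sum_Pow_union:
  fixes F :: "'a set \<Rightarrow> 'b::comm_monoid_add"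
  assumes "finite A" "finite D" "A \<inter> D = {}"
  shows "(\<Sum>\<Theta>\<in>Pow (A \<union> D). F \<Theta>) = (\<Sum>B\<in>Pow A. \<Sum>C\<in>Pow D. F (B \<union> C))"
  using assms(2,1,3)
proof (induction D arbitrary: F rule: finite_induct)
  case (insert i D)
  have "(\<Sum>\<Theta>\<in>Pow (A \<union> insert i D). F \<Theta>) = (\<Sum>\<Theta>\<in>Pow (A \<union> D). F \<Theta> + F (insert i \<Theta>))"
    using insert by (simp add: sum_Pow_insert del: Pow_insert)
  also have "\<dots> = (\<Sum>B\<in>Pow A. \<Sum>C\<in>Pow D. F (B \<union> C) + F (insert i (B \<union> C)))"
    using insert by (subst insert.IH) auto
  finally show ?case using insert by (simp add: sum_Pow_insert del: Pow_insert)
qed simp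

text \<open>Conditioning on indicator \<open>i\<close>: a zero changes \<open>(a, x)\<close> to
  \<open>(a + 1, x)\<close>, a one changes it to \<open>(a + 1, x + 1)\<close> and raises the count
  by 1. All three moments follow by induction from this with different \<open>f\<close>.\<close>

lemma prior_weight_moment_insert:
  assumes "finite D" "i \<notin> D"
  shows "(\<Sum>C\<in>Pow (insert i D). prior_weight (a + card (insert i D)) (x + card C) * f (card C))
    = (\<Sum>C\<in>Pow D. prior_weight (Suc a + card D) (x + card C) * f (card C))
      + (\<Sum>C\<in>Pow D. prior_weight (Suc a + card D) (Suc x + card C) * f (Suc (card C)))"
proof -
  have "card (insert i C) = Suc (card C)" if "C \<in> Pow D" for C
    using assms that by (metis PowD card_insert_disjoint finite_subset subsetD)
  then show ?thesis
    using assms by (simp add: sum_Pow_insert sum.distrib del: Pow_insert)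
qed

lemma prior_weight_marginal:
  assumes "finite D" "x \<le> a"
  shows "(\<Sum>C\<in>Pow D. prior_weight (a + card D) (x + card C)) = prior_weight a x"
  using assms
proof (induction D arbitrary: a x rule: finite_induct)
  case (insert i D)
  have "(\<Sum>C\<in>Pow (insert i D). prior_weight (a + card (insert i D)) (x + card C)) = prior_weight (Suc a) x + prior_weight (Suc a) (Suc x)"
    using prior_weight_moment_insert[of D i a x "\<lambda>_. 1"] insert.IH[of x "Suc a"] insert.IH[of "Suc x" "Suc a"] insert
    by (simp del: Pow_insert)
  also have "\<dots> = prior_weight a x"
    by (rule prior_weight_split[OF insert.prems])
  finally show ?case .
qed simp

lemma prior_weight_first_moment:
  assumes "finite D" "x \<le> a"
  shows "(\<Sum>C\<in>Pow D. prior_weight (a + card D) (x + card C) * real (card C))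
    = prior_weight a x * (real (card D) * (real x + 1) / (real a + 2))"
  using assms
proof (induction D arbitrary: a x rule: finite_induct)
  case (insert i D)
  define m where "m = real (card D)"
  have *: "(\<Sum>C\<in>Pow D. prior_weight (Suc a + card D) (Suc x + card C) * real (Suc (card C)))
    = (\<Sum>C\<in>Pow D. prior_weight (Suc a + card D) (Suc x + card C) * real (card C))
    + (\<Sum>C\<in>Pow D. prior_weight (Suc a + card D) (Suc x + card C))"
    by (simp add: sum.distrib[symmetric] algebra_simps)
  have "(\<Sum>C\<in>Pow (insert i D). prior_weight (a + card (insert i D)) (x + card C) * real (card C)) =
      prior_weight (Suc a) x * (m * (real x + 1) / (real a + 3))
      + (prior_weight (Suc a) (Suc x) * (m * (real x + 2) / (real a + 3)) + prior_weight (Suc a) (Suc x))"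
    unfolding prior_weight_moment_insert[OF insert(1,2)] *
    using insert.IH[of x "Suc a"] insert.IH[of "Suc x" "Suc a"] prior_weight_marginal[of D "Suc x" "Suc a"]
      insert by (simp add: m_def algebra_simps)
  also have "\<dots> = prior_weight a x * ((m + 1) * (real x + 1) / (real a + 2))"
    using insert.prems unfolding prior_weight_Suc[OF insert.prems] prior_weight_Suc_Suc
    by (simp add: divide_simps) (simp add: algebra_simps)
  finally show ?case using insert by (simp add: m_def add.commute)
qed simp

text \<open>The square of a count is the count plus the number of ordered pairs of distinct ones;
  two given unseen indicators are both ones with probability
  \<open>(x + 1) (x + 2) / ((a + 2) (a + 3))\<close>.\<close>

lemma prior_weight_second_moment:
  assumes "finite D" "x \<le> a"
  shows "(\<Sum>C\<in>Pow D. prior_weight (a + card D) (x + card C) * (real (card C))\<^sup>2)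
    = prior_weight a x * (real (card D) * (real x + 1) / (real a + 2)
       + real (card D) * (real (card D) - 1) * (real x + 1) * (real x + 2) / ((real a + 2) * (real a + 3)))"
  using assms
proof (induction D arbitrary: a x rule: finite_induct)
  case (insert i D)
  define m where "m = real (card D)"
  have shift: "real (Suc a) + 2 = real a + 3" "real (Suc a) + 3 = real a + 4"
    "real (Suc x) + 1 = real x + 2" "real (Suc x) + 2 = real x + 3"
    by simp_all
  have le: "x \<le> Suc a" "Suc x \<le> Suc a" using insert.prems by simp_all
  have *: "(\<Sum>C\<in>Pow D. prior_weight (Suc a + card D) (Suc x + card C) * (real (Suc (card C)))\<^sup>2)
    = (\<Sum>C\<in>Pow D. prior_weight (Suc a + card D) (Suc x + card C) * (real (card C))\<^sup>2)
    + 2 * (\<Sum>C\<in>Pow D. prior_weight (Suc a + card D) (Suc x + card C) * real (card C))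
    + (\<Sum>C\<in>Pow D. prior_weight (Suc a + card D) (Suc x + card C))"
    by (simp add: sum.distrib[symmetric] sum_distrib_left algebra_simps power2_eq_square)
  have "(\<Sum>C\<in>Pow (insert i D). prior_weight (a + card (insert i D)) (x + card C) * (real (card C))\<^sup>2) =
      prior_weight (Suc a) x * (m * (real x + 1) / (real a + 3) + m * (m - 1) * (real x + 1) * (real x + 2) / ((real a + 3) * (real a + 4)))
      + (prior_weight (Suc a) (Suc x) * (m * (real x + 2) / (real a + 3) + m * (m - 1) * (real x + 2) * (real x + 3) / ((real a + 3) * (real a + 4)))
      + 2 * (prior_weight (Suc a) (Suc x) * (m * (real x + 2) / (real a + 3))) + prior_weight (Suc a) (Suc x))"
    unfolding prior_weight_moment_insert[OF insert(1,2), where f = "\<lambda>c. (real c)\<^sup>2"] * insert.IH[OF le(1)] insert.IH[OF le(2)]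
      prior_weight_marginal[OF insert.hyps(1) le(2)] prior_weight_first_moment[OF insert.hyps(1) le(2)] m_def shift
    by (rule refl)
  also have "\<dots> = prior_weight a x * ((m + 1) * (real x + 1) / (real a + 2)
     + (m + 1) * m * (real x + 1) * (real x + 2) / ((real a + 2) * (real a + 3)))"
    unfolding prior_weight_Suc[OF insert.prems] prior_weight_Suc_Suc divide_inverse inverse_mult_distrib
    by (rule second_moment_identity) (simp_all add: field_simps)
  finally show ?case using insert by (simp add: m_def add.commute)
qed simp

text \<open>The risk of a guess \<open>g\<close> is the posterior variance plus the squared distance
  to the posterior mean \<open>u\<close>, which is dropped. The dependence of the variance on
  \<open>x\<close> is absorbed into the weight, as if one further one and one further zero had been
  seen, so that the bound can be summed over all observations.\<close>

lemma prior_weight_conditional_risk: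
  assumes "finite D" "x \<le> a"
  defines "m \<equiv> real (card D)"
  shows "prior_weight (a + 2) (x + 1) * (m * (m + real a + 2) / (real a + 2))
    \<le> (\<Sum>C\<in>Pow D. prior_weight (a + card D) (x + card C) * (g - real (card C))\<^sup>2)"
proof -
  define u where "u = m * (real x + 1) / (real a + 2)"
  have "(\<Sum>C\<in>Pow D. prior_weight (a + card D) (x + card C) * (g - real (card C))\<^sup>2)
    = g\<^sup>2 * (\<Sum>C\<in>Pow D. prior_weight (a + card D) (x + card C))
      - 2 * g * (\<Sum>C\<in>Pow D. prior_weight (a + card D) (x + card C) * real (card C))
      + (\<Sum>C\<in>Pow D. prior_weight (a + card D) (x + card C) * (real (card C))\<^sup>2)"
    by (simp add: sum_distrib_left sum.distrib[symmetric] sum_subtractf[symmetric] power2_diff algebra_simps)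
  also have "\<dots> = prior_weight a x * ((g - u)\<^sup>2 + (u + m * (m - 1) * (real x + 1) * (real x + 2) / ((real a + 2) * (real a + 3)) - u\<^sup>2))"
    unfolding prior_weight_marginal[OF assms(1,2)] prior_weight_first_moment[OF assms(1,2)] prior_weight_second_moment[OF assms(1,2)]
    by (simp only: m_def[symmetric] u_def[symmetric]) (simp add: power2_diff algebra_simps)
  also have "\<dots> \<ge> prior_weight a x * (u + m * (m - 1) * (real x + 1) * (real x + 2) / ((real a + 2) * (real a + 3)) - u\<^sup>2)"
    by (intro mult_left_mono prior_weight_nonneg) simp
  also have "u + m * (m - 1) * (real x + 1) * (real x + 2) / ((real a + 2) * (real a + 3)) - u\<^sup>2
    = (real x + 1) * (real a - real x + 1) / ((real a + 2) * (real a + 3)) * (m * (m + real a + 2) / (real a + 2))"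
    unfolding u_def divide_inverse inverse_mult_distrib
    by (rule variance_identity) (simp_all add: field_simps)
  also have "prior_weight a x * \<dots> = prior_weight (a + 2) (x + 1) * (m * (m + real a + 2) / (real a + 2))"
  proof -
    have "prior_weight (a + 2) (x + 1) = prior_weight (Suc a) x * (real x + 1) / (real a + 3)"
      using prior_weight_Suc_Suc[of "Suc a" x] by (simp add: add.commute)
    also have "\<dots> = prior_weight a x * ((real x + 1) * (real a - real x + 1) / ((real a + 2) * (real a + 3)))"
      unfolding prior_weight_Suc[OF assms(2)] by (simp add: mult_ac)
    finally show ?thesis by (simp only: mult.assoc)
  qed
  finally show ?thesis .
qed

lemma prior_weight_bayes_risk:
  assumes "finite I" "A \<subseteq> I"
  shows "(real (card I) - real (card A)) * (real (card I) + 2) / (6 * (real (card A) + 2))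
    \<le> (\<Sum>\<Theta>\<in>Pow I. prior_weight (card I) (card \<Theta>) * (g (\<Theta> \<inter> A) - real (card \<Theta>))\<^sup>2)"
proof -
  define D where "D = I - A"
  define K where "K = real (card D) * (real (card D) + real (card A) + 2) / (real (card A) + 2)"
  have fin: "finite A" "finite D" and disj: "A \<inter> D = {}" and I: "I = A \<union> D"
    using assms finite_subset by (auto simp: D_def)
  have cI: "card I = card A + card D" unfolding I using fin disj by (rule card_Un_disjoint)
  have "(real (card I) - real (card A)) * (real (card I) + 2) / (6 * (real (card A) + 2)) = prior_weight 2 1 * K"
    by (simp add: K_def cI prior_weight_def eval_nat_numeral divide_simps)
  \<comment> \<open>The shifted weights sum to the weight of one given one and one given zero, which
    is 1/6; this is the source of the 6.\<close>
  also have "prior_weight 2 1 = (\<Sum>B\<in>Pow A. prior_weight (card A + 2) (card B + 1))"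
    using prior_weight_marginal[OF fin(1), of 1 2] by (simp add: add.commute)
  also have "\<dots> * K = (\<Sum>B\<in>Pow A. prior_weight (card A + 2) (card B + 1) * K)"
    by (rule sum_distrib_right)
  \<comment> \<open>Once the revealed ones \<open>B\<close> are known, guessing the total amounts to
    guessing the number of unseen ones by \<open>g B - card B\<close>.\<close>
  also have "\<dots> \<le> (\<Sum>B\<in>Pow A. \<Sum>C\<in>Pow D. prior_weight (card A + card D) (card B + card C) *
      ((g B - real (card B)) - real (card C))\<^sup>2)"
    unfolding K_def
    by (intro sum_mono prior_weight_conditional_risk fin) (auto intro: card_mono fin)
  also have "\<dots> = (\<Sum>B\<in>Pow A. \<Sum>C\<in>Pow D. prior_weight (card I) (card (B \<union> C)) *
      (g ((B \<union> C) \<inter> A) - real (card (B \<union> C)))\<^sup>2)"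
  proof (intro sum.cong refl)
    fix B C assume BC: "B \<in> Pow A" "C \<in> Pow D"
    then have "(B \<union> C) \<inter> A = B" "card (B \<union> C) = card B + card C"
      using disj fin by (auto intro!: card_Un_disjoint intro: finite_subset)
    then show "prior_weight (card A + card D) (card B + card C) * (g B - real (card B) - real (card C))\<^sup>2 =
      prior_weight (card I) (card (B \<union> C)) * (g ((B \<union> C) \<inter> A) - real (card (B \<union> C)))\<^sup>2"
      by (simp add: cI algebra_simps)
  qed
  also have "\<dots> = (\<Sum>\<Theta>\<in>Pow I. prior_weight (card I) (card \<Theta>) * (g (\<Theta> \<inter> A) - real (card \<Theta>))\<^sup>2)"
    unfolding I by (rule sum_Pow_union[OF fin disj, symmetric])
  finally show ?thesis .
qed

lemma prior_weight_total: "finite I \<Longrightarrow> (\<Sum>\<Theta>\<in>Pow I. prior_weight (card I) (card \<Theta>)) = 1"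
  using prior_weight_marginal[of I 0 0] by (simp add: prior_weight_def)

subsection \<open>Random star forests\<close>

text \<open>Blocks are runs of \<open>k + 1\<close> consecutive numbers: the quotient by
  \<open>k + 1\<close> is the block, and remainder 0 marks its centre.\<close>

definition gadget :: "nat \<Rightarrow> nat \<Rightarrow> nat" where
  "gadget k u = u div Suc k"

definition centre :: "nat \<Rightarrow> nat \<Rightarrow> bool" where
  "centre k u \<longleftrightarrow> u mod Suc k = 0"

lemma centre_eq: "centre k u \<Longrightarrow> u = gadget k u * Suc k"
  using div_mult_mod_eq[of u "Suc k"] unfolding centre_def gadget_def by linarith

lemma leaf_eq:
  assumes "\<not> centre k u"
  shows "u mod Suc k \<in> {1..k}" "u = gadget k u * Suc k + u mod Suc k"
proof -
  have "u mod Suc k < Suc k" by (rule mod_less_divisor) (rule zero_less_Suc)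
  with assms show "u mod Suc k \<in> {1..k}" unfolding centre_def atLeastAtMost_iff by linarith
  show "u = gadget k u * Suc k + u mod Suc k"
    unfolding gadget_def by (rule div_mult_mod_eq[symmetric])
qed

lemma gadget_add: "j \<le> k \<Longrightarrow> gadget k (i * Suc k + j) = i"
  unfolding gadget_def using div_mult_self3[of "Suc k" i j] by simp

lemma centre_add: "j \<le> k \<Longrightarrow> centre k (i * Suc k + j) \<longleftrightarrow> j = 0"
  unfolding centre_def using mod_mult_self3[of i "Suc k" j] by simp

lemma centre_unique: "centre k u \<Longrightarrow> centre k v \<Longrightarrow> gadget k u = gadget k v \<Longrightarrow> u = v"
  using centre_eq[of k u] centre_eq[of k v] by metis

definition star_forest :: "nat \<Rightarrow> nat \<Rightarrow> nat set \<Rightarrow> nat pair_pre_digraph" where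
  "star_forest N k \<Theta> = \<lparr>pverts = {..<N}, parcs = {(u, v). u < N \<and> v < N \<and>
     gadget k u = gadget k v \<and> gadget k u \<in> \<Theta> \<and> centre k u \<noteq> centre k v}\<rparr>"

lemma pverts_star_forest [simp]: "pverts (star_forest N k \<Theta>) = {..<N}"
  by (simp add: star_forest_def)

lemma parcs_star_forest:
  "(u, v) \<in> parcs (star_forest N k \<Theta>) \<longleftrightarrow> u < N \<and> v < N \<and>
     gadget k u = gadget k v \<and> gadget k u \<in> \<Theta> \<and> centre k u \<noteq> centre k v"
  by (simp add: star_forest_def)

lemma pair_graph_star_forest: "pair_graph (star_forest N k \<Theta>)"
  unfolding pair_graph_iff by (auto simp: parcs_star_forest intro!: symI)

lemma pcas_end_in_verts: "pcas u p v \<Longrightarrow> v \<in> set (pawalk_verts u p)"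
proof (induction p arbitrary: u)
  case (Cons e p)
  from Cons.prems have "pcas (snd e) p v" by simp
  then have "v \<in> set (pawalk_verts (snd e) p)" by (rule Cons.IH)
  then show ?case by simp
qed simp

text \<open>An arc stays in its block and joins a centre to a leaf, and a block has one centre. So
  two steps from a centre lead back to it, and in a longer cycle a vertex would recur too
  early.\<close>

lemma star_forest_forest: "undirected_forest (star_forest N k \<Theta>)"
proof -
  let ?G = "star_forest N k \<Theta>"
  interpret pair_graph ?G by (rule pair_graph_star_forest)
  have False if w: "cycle w" "3 \<le> length w" for w
  proof -
    obtain e1 w1 where w1: "w = e1 # w1" "2 \<le> length w1" using w(2) by (cases w) auto
    obtain e2 w2 where w2: "w1 = e2 # w2" "1 \<le> length w2" using w1(2) by (cases w1) auto
    obtain e3 r where w3: "w2 = e3 # r" using w2(2) by (cases w2) auto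
    have wr: "w = e1 # e2 # e3 # r" using w1 w2 w3 by simp
    from w(1) obtain u where u: "awalk u w u" "distinct (tl (pawalk_verts u w))"
      unfolding cycle_def by blast
    obtain a b c where abc: "a = snd e1" "b = snd e2" "c = snd e3" by simp
    have "pcas u w u" "set w \<subseteq> parcs ?G" using u(1) by (simp_all add: awalk_def)
    then have e: "e1 = (u, a)" "e2 = (a, b)" "e3 = (b, c)" "pcas c r u" "set w \<subseteq> parcs ?G"
      unfolding wr abc by (simp_all add: prod_eq_iff)
    \<comment> \<open>The remaining list starts at \<open>c\<close> and ends at \<open>u\<close>, so
      distinctness separates \<open>a\<close> from \<open>c\<close> and \<open>b\<close> from
      \<open>u\<close>.\<close>
    have dist: "distinct (a # b # pawalk_verts c r)"
      using u(2) unfolding wr e by simp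
    have arcs: "(u, a) \<in> parcs ?G" "(a, b) \<in> parcs ?G" "(b, c) \<in> parcs ?G"
      using e wr by auto
    have c: "c \<in> set (pawalk_verts c r)" by (cases r) (use e(4) in auto)
    have u': "u \<in> set (pawalk_verts c r)" using e(4) by (rule pcas_end_in_verts)
    show False
    proof (cases "centre k a")
      case True
      then have "a = c" using arcs by (rule_tac centre_unique[of k]) (auto simp: parcs_star_forest)
      then show False using c dist by auto
    next
      case False
      then have "u = b" using arcs by (rule_tac centre_unique[of k]) (auto simp: parcs_star_forest)
      then show False using u' dist by auto
    qed
  qed
  then show ?thesis unfolding undirected_forest_def using pair_graph_star_forest by blast
qed

lemma star_forest_degree:
  assumes k: "1 \<le> k"
  shows "out_degree (with_proj (star_forest N k \<Theta>)) v \<le> k"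
proof (cases "centre k v")
  case True
  have "out_arcs (with_proj (star_forest N k \<Theta>)) v \<subseteq> (\<lambda>j. (v, v + j)) ` {1..k}"
  proof
    fix e assume "e \<in> out_arcs (with_proj (star_forest N k \<Theta>)) v"
    then obtain y where e: "e = (v, y)" and y: "gadget k v = gadget k y" "\<not> centre k y"
      using True by (cases e) (auto simp: out_arcs_def parcs_star_forest)
    have "v = gadget k y * Suc k" using centre_eq[OF True] unfolding y(1) .
    then have "y = v + y mod Suc k" using leaf_eq(2)[OF y(2)] by linarith
    then show "e \<in> (\<lambda>j. (v, v + j)) ` {1..k}" using e leaf_eq(1)[OF y(2)] by blast
  qed
  then have "out_degree (with_proj (star_forest N k \<Theta>)) v \<le> card ((\<lambda>j. (v, v + j)) ` {1..k})"
    unfolding out_degree_def by (intro card_mono) auto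
  also have "\<dots> \<le> k" using card_image_le[of "{1..k}" "\<lambda>j. (v, v + j)"] by simp
  finally show ?thesis .
next
  case False
  have "out_arcs (with_proj (star_forest N k \<Theta>)) v \<subseteq> {(v, gadget k v * Suc k)}"
  proof
    fix e assume "e \<in> out_arcs (with_proj (star_forest N k \<Theta>)) v"
    then obtain y where e: "e = (v, y)" and y: "gadget k v = gadget k y" "centre k y"
      using False by (cases e) (auto simp: out_arcs_def parcs_star_forest)
    then show "e \<in> {(v, gadget k v * Suc k)}" using centre_eq[OF y(2)] by (metis singletonI)
  qed
  then have "out_degree (with_proj (star_forest N k \<Theta>)) v \<le> card {(v, gadget k v * Suc k)}"
    unfolding out_degree_def by (intro card_mono) auto
  with k show ?thesis by simp
qed

lemma card_parcs_star_forest: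
  assumes M: "M * Suc k \<le> N" and \<Theta>: "\<Theta> \<subseteq> {..<M}"
  shows "card (parcs (star_forest N k \<Theta>)) = 2 * k * card \<Theta>"
proof -
  \<comment> \<open>Block \<open>i\<close> and leaf offset \<open>j\<close> parametrise the arcs
    from centre to leaf; the opposite arcs form a disjoint copy.\<close>
  define f where "f = (\<lambda>(i, j). (i * Suc k, i * Suc k + j))"
  define X where "X = f ` (\<Theta> \<times> {1..k})"
  have fin: "finite \<Theta>" using \<Theta> finite_subset by auto
  have bound: "i * Suc k + j < N" if "i \<in> \<Theta>" "j \<le> k" for i j
  proof -
    have "Suc i \<le> M" using that \<Theta> by auto
    then have "Suc i * Suc k \<le> M * Suc k" by (rule mult_le_mono1)
    with that M show ?thesis by simp
  qed
  have inX: "e \<in> X" if e: "e \<in> parcs (star_forest N k \<Theta>)" "centre k (fst e)" for e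
  proof -
    obtain u v where uv: "e = (u, v)" by force
    with e have *: "centre k u" "\<not> centre k v" "gadget k u = gadget k v" "gadget k u \<in> \<Theta>"
      by (auto simp: parcs_star_forest)
    have "e = f (gadget k u, v mod Suc k)"
      unfolding uv f_def using centre_eq[OF *(1)] leaf_eq(2)[OF *(2)] *(3) by simp
    moreover have "(gadget k u, v mod Suc k) \<in> \<Theta> \<times> {1..k}"
      using *(4) leaf_eq(1)[OF *(2)] by blast
    ultimately show ?thesis unfolding X_def by (rule image_eqI)
  qed
  have "parcs (star_forest N k \<Theta>) = X \<union> prod.swap ` X"
  proof (intro set_eqI iffI)
    fix e assume e: "e \<in> parcs (star_forest N k \<Theta>)"
    have sw: "prod.swap e \<in> parcs (star_forest N k \<Theta>)"
      using e by (cases e) (auto simp: parcs_star_forest)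
    show "e \<in> X \<union> prod.swap ` X"
    proof (cases "centre k (fst e)")
      case True then show ?thesis using inX[OF e] by auto
    next
      case False
      then have "centre k (fst (prod.swap e))" using e by (cases e) (auto simp: parcs_star_forest)
      then have "prod.swap e \<in> X" by (rule inX[OF sw])
      then have "prod.swap (prod.swap e) \<in> prod.swap ` X" by (rule imageI)
      then show ?thesis by simp
    qed
  next
    fix e assume "e \<in> X \<union> prod.swap ` X"
    then obtain i j where ij: "i \<in> \<Theta>" "j \<in> {1..k}"
      and e: "e = (i * Suc k, i * Suc k + j) \<or> e = (i * Suc k + j, i * Suc k)"
      unfolding X_def f_def by force
    have "i * Suc k + 0 < N" "i * Suc k + j < N" using bound[OF ij(1), of 0] bound[OF ij(1), of j] ij(2) by simp_all
    moreover have "gadget k (i * Suc k + 0) = i" "gadget k (i * Suc k + j) = i"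
      "centre k (i * Suc k + 0)" "\<not> centre k (i * Suc k + j)"
      using gadget_add[of 0 k i] gadget_add[of j k i] centre_add[of 0 k i] centre_add[of j k i] ij(2)
      by simp_all
    ultimately show "e \<in> parcs (star_forest N k \<Theta>)"
      using e ij(1) unfolding add_0_right by (elim disjE) (simp_all only: parcs_star_forest simp_thms)
  qed
  moreover have "X \<inter> prod.swap ` X = {}"
  proof -
    have "centre k (fst e) \<and> \<not> centre k (snd e)" if "e \<in> X" for e
    proof -
      from that obtain i j where "j \<in> {1..k}" "e = (i * Suc k + 0, i * Suc k + j)"
        unfolding X_def f_def by force
      then show ?thesis using centre_add[of 0 k i] centre_add[of j k i] by simp
    qed
    note X = this
    show ?thesis
    proof (rule equals0I)
      fix e assume "e \<in> X \<inter> prod.swap ` X"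
      then obtain e' where "e \<in> X" "e' \<in> X" "e = prod.swap e'" by auto
      then show False using X[of e] X[of e'] by simp
    qed
  qed
  moreover have "finite X" using fin by (simp add: X_def)
  ultimately have "card (parcs (star_forest N k \<Theta>)) = card X + card (prod.swap ` X)"
    by (simp add: card_Un_disjoint)
  also have "card (prod.swap ` X) = card X" by (rule card_image) auto
  also have "card X = card \<Theta> * k"
  proof -
    have "inj_on f (\<Theta> \<times> {1..k})"
      by (rule inj_onI) (auto simp: f_def simp del: mult_Suc_right)
    then show ?thesis by (simp add: X_def card_image card_cartesian_product)
  qed
  finally show ?thesis by simp
qed

lemma cc_star_forest:
  assumes "M * Suc k \<le> N" "\<Theta> \<subseteq> {..<M}"
  shows "real (cc (with_proj (star_forest N k \<Theta>))) = real N - real k * real (card \<Theta>)"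
proof -
  have "2 * cc (with_proj (star_forest N k \<Theta>)) + 2 * (k * card \<Theta>) = 2 * N"
    using cc_forest[OF star_forest_forest, of N k \<Theta>] card_parcs_star_forest[OF assms] by (simp add: mult_ac)
  then have "cc (with_proj (star_forest N k \<Theta>)) + k * card \<Theta> = N" by linarith
  then show ?thesis by (simp flip: of_nat_mult of_nat_add)
qed

lemma star_forest_in_forests:
  assumes "1 \<le> k" "k \<le> d"
  shows "with_proj (star_forest N k \<Theta>) \<in> forests N d"
proof -
  have "out_degree (with_proj (star_forest N k \<Theta>)) v \<le> d" for v
    using star_forest_degree[OF assms(1), of N \<Theta> v] assms(2) by simp
  then show ?thesis
    unfolding forests_def using star_forest_forest[of N k \<Theta>] by (intro imageI) simp
qed

section \<open>Information in a sample and the Bayes risk\<close>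

definition revealed :: "nat \<Rightarrow> nat \<Rightarrow> nat set \<Rightarrow> nat set" where
  "revealed k M S = {i \<in> {..<M}. i * Suc k \<in> S \<and> (\<exists>j\<in>{1..k}. i * Suc k + j \<in> S)}"

text \<open>A surviving edge has its centre and a leaf in the sample, so its block is revealed. As
  \<open>revealed\<close> depends on the sample alone, the sample can be fixed while the prior is
  averaged.\<close>

lemma induce_star_forest_revealed:
  assumes \<Theta>: "\<Theta> \<subseteq> {..<M}"
  shows "with_proj (star_forest N k \<Theta>) \<restriction> S = with_proj (star_forest N k (\<Theta> \<inter> revealed k M S)) \<restriction> S"
proof -
  have rev: "gadget k x \<in> revealed k M S"
    if "x \<in> S" "y \<in> S" "gadget k x = gadget k y" "gadget k x \<in> \<Theta>" "centre k x" "\<not> centre k y" for x y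
  proof -
    have "gadget k x * Suc k \<in> S" using centre_eq[OF that(5)] that(1) by metis
    moreover have "gadget k x * Suc k + y mod Suc k \<in> S"
      using leaf_eq(2)[OF that(6)] that(2,3) by metis
    ultimately show ?thesis
      using leaf_eq(1)[OF that(6)] that(4) \<Theta> unfolding revealed_def by blast
  qed
  have "{e \<in> parcs (star_forest N k \<Theta>). fst e \<in> S \<and> snd e \<in> S}
    = {e \<in> parcs (star_forest N k (\<Theta> \<inter> revealed k M S)). fst e \<in> S \<and> snd e \<in> S}"
  proof (intro Collect_cong)
    fix e
    show "(e \<in> parcs (star_forest N k \<Theta>) \<and> fst e \<in> S \<and> snd e \<in> S) \<longleftrightarrow>
      (e \<in> parcs (star_forest N k (\<Theta> \<inter> revealed k M S)) \<and> fst e \<in> S \<and> snd e \<in> S)"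
      using rev[of "fst e" "snd e"] rev[of "snd e" "fst e"]
      by (cases e) (auto simp: parcs_star_forest)
  qed
  then show ?thesis by (simp add: induce_subgraph_def)
qed

text \<open>For a fixed sample the revealed blocks play the role of \<open>A\<close> in
  \<open>prior_weight_bayes_risk\<close>. Convexity in their number then permits averaging over
  samples, where the mean number is at most \<open>M s\<close>.\<close>

lemma star_forest_bayes_risk:
  assumes k: "1 \<le> k" and M: "M * Suc k \<le> N" and p: "0 \<le> p" "p \<le> 1" and s: "0 \<le> s"
    and rev: "\<And>i. i < M \<Longrightarrow> sample_mean p {..<N} (\<lambda>S. of_bool (i \<in> revealed k M S)) \<le> s"
  shows "(real k)\<^sup>2 * ((real M + 2) / 6 * ((real M + 2) / (real M * s + 2) - 1))
    \<le> (\<Sum>\<Theta>\<in>Pow {..<M}. prior_weight M (card \<Theta>) * mse p h (with_proj (star_forest N k \<Theta>)))"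
proof -
  define G where "G \<Theta> = with_proj (star_forest N k \<Theta>)" for \<Theta>
  define y where "y = real M * s + 2"
  have y: "0 < y" using s by (simp add: y_def add_nonneg_pos)
  have cond: "(real k)\<^sup>2 * ((real M + 2) / 6 * ((real M + 2) * (2 / y - (real (card (revealed k M S)) + 2) / y\<^sup>2) - 1))
    \<le> (\<Sum>\<Theta>\<in>Pow {..<M}. prior_weight M (card \<Theta>) * (h (G \<Theta> \<restriction> S) - real (cc (G \<Theta>)))\<^sup>2)" for S
  proof -
    let ?A = "revealed k M S"
    define a where "a = real (card ?A)"
    \<comment> \<open>The number of components is \<open>N - k * card \<Theta>\<close>, so a guess
      for it is rescaled to a guess for the number of stars; the factor \<open>k\<^sup>2\<close>
      comes from this.\<close>
    define g where "g B = (real N - h (G B \<restriction> S)) / real k" for B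
    \<comment> \<open>The tangent at \<open>y\<close> of the convex function \<open>1 / (a + 2)\<close> of \<open>a + 2\<close>.\<close>
    have "2 / y - (a + 2) / y\<^sup>2 \<le> 1 / (a + 2)"
    proof -
      have a2: "0 < a + 2" by (simp add: a_def add_nonneg_pos)
      have "0 \<le> (y - (a + 2))\<^sup>2 / (y\<^sup>2 * (a + 2))" using a2 by simp
      also have "\<dots> = 1 / (a + 2) - (2 / y - (a + 2) / y\<^sup>2)"
        using a2 y by (simp add: field_simps power2_eq_square)
      finally show ?thesis by simp
    qed
    then have "(real M + 2) * (2 / y - (a + 2) / y\<^sup>2) - 1 \<le> (real M + 2) * (1 / (a + 2)) - 1"
      by (intro diff_right_mono mult_left_mono) auto
    also have "\<dots> = (real M - a) / (a + 2)"
      by (simp add: a_def field_simps)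
    finally have "(real M + 2) / 6 * ((real M + 2) * (2 / y - (a + 2) / y\<^sup>2) - 1)
       \<le> (real M + 2) / 6 * ((real M - a) / (a + 2))"
      by (intro mult_left_mono) auto
    also have "\<dots> = (real (card {..<M}) - real (card ?A)) * (real (card {..<M}) + 2) / (6 * (real (card ?A) + 2))"
      by (simp add: a_def)
    also have "\<dots> \<le> (\<Sum>\<Theta>\<in>Pow {..<M}. prior_weight (card {..<M}) (card \<Theta>) * (g (\<Theta> \<inter> ?A) - real (card \<Theta>))\<^sup>2)"
      by (rule prior_weight_bayes_risk) (auto simp: revealed_def)
    finally have "(real k)\<^sup>2 * ((real M + 2) / 6 * ((real M + 2) * (2 / y - (a + 2) / y\<^sup>2) - 1))
      \<le> (real k)\<^sup>2 * (\<Sum>\<Theta>\<in>Pow {..<M}. prior_weight M (card \<Theta>) * (g (\<Theta> \<inter> ?A) - real (card \<Theta>))\<^sup>2)"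
      by (intro mult_left_mono) auto
    also have "\<dots> = (\<Sum>\<Theta>\<in>Pow {..<M}. prior_weight M (card \<Theta>) * (h (G \<Theta> \<restriction> S) - real (cc (G \<Theta>)))\<^sup>2)"
      unfolding sum_distrib_left
    proof (rule sum.cong[OF refl])
      fix \<Theta> assume "\<Theta> \<in> Pow {..<M}"
      then have \<Theta>: "\<Theta> \<subseteq> {..<M}" by simp
      have "h (G \<Theta> \<restriction> S) = h (G (\<Theta> \<inter> ?A) \<restriction> S)"
        unfolding G_def using induce_star_forest_revealed[OF \<Theta>, of N k S] by simp
      also have "\<dots> = real N - real k * g (\<Theta> \<inter> ?A)" using k by (simp add: g_def)
      finally have "h (G \<Theta> \<restriction> S) - real (cc (G \<Theta>)) = - (real k * (g (\<Theta> \<inter> ?A) - real (card \<Theta>)))"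
        unfolding G_def cc_star_forest[OF M \<Theta>] by (simp add: algebra_simps)
      then show "(real k)\<^sup>2 * (prior_weight M (card \<Theta>) * (g (\<Theta> \<inter> ?A) - real (card \<Theta>))\<^sup>2)
        = prior_weight M (card \<Theta>) * (h (G \<Theta> \<restriction> S) - real (cc (G \<Theta>)))\<^sup>2"
        by (simp add: power_mult_distrib)
    qed
    finally show ?thesis by (simp add: a_def)
  qed
  have "sample_mean p {..<N} (\<lambda>S. real (card (revealed k M S)))
    = (\<Sum>i<M. sample_mean p {..<N} (\<lambda>S. of_bool (i \<in> revealed k M S)))"
    unfolding sample_mean_sum[symmetric]
    by (rule sample_mean_cong) (simp add: revealed_def Int_def)
  also have "\<dots> \<le> (\<Sum>i<M. s)" using rev by (intro sum_mono) auto
  finally have mean_a: "sample_mean p {..<N} (\<lambda>S. real (card (revealed k M S))) + 2 \<le> y"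
    by (simp add: y_def)
  define c1 where "c1 = (real k)\<^sup>2 * ((real M + 2) / 6 * ((real M + 2) * (2 / y - 2 / y\<^sup>2) - 1))"
  define c2 where "c2 = (real k)\<^sup>2 * ((real M + 2) / 6 * ((real M + 2) / y\<^sup>2))"
  \<comment> \<open>The tangent bound is affine and decreasing in the number of revealed blocks, so
    its mean needs only an upper bound on the mean number; at \<open>y - 2\<close> the tangent
    touches the curve.\<close>
  have lin: "(real k)\<^sup>2 * ((real M + 2) / 6 * ((real M + 2) * (2 / y - (t + 2) / y\<^sup>2) - 1)) = c1 + (- c2) * t" for t
    by (simp add: c1_def c2_def algebra_simps add_divide_distrib)
  have "(real k)\<^sup>2 * ((real M + 2) / 6 * ((real M + 2) / y - 1))
    = (real k)\<^sup>2 * ((real M + 2) / 6 * ((real M + 2) * (2 / y - ((y - 2) + 2) / y\<^sup>2) - 1))"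
    using y by (simp add: power2_eq_square)
  also have "\<dots> = c1 + (- c2) * (y - 2)" by (rule lin)
  also have "\<dots> \<le> c1 + (- c2) * sample_mean p {..<N} (\<lambda>S. real (card (revealed k M S)))"
  proof -
    have "0 \<le> c2" by (simp add: c2_def)
    moreover have "sample_mean p {..<N} (\<lambda>S. real (card (revealed k M S))) \<le> y - 2" using mean_a by simp
    ultimately show ?thesis by (simp add: mult_left_mono)
  qed
  also have "\<dots> = sample_mean p {..<N} (\<lambda>S. c1 + (- c2) * real (card (revealed k M S)))"
    by (simp only: sample_mean_add sample_mean_cmult sample_mean_const[OF finite_lessThan])
  also have "\<dots> \<le> sample_mean p {..<N} (\<lambda>S. \<Sum>\<Theta>\<in>Pow {..<M}. prior_weight M (card \<Theta>) * (h (G \<Theta> \<restriction> S) - real (cc (G \<Theta>)))\<^sup>2)"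
    by (rule sample_mean_mono[OF p]) (use cond[unfolded lin] in simp)
  also have "\<dots> = (\<Sum>\<Theta>\<in>Pow {..<M}. prior_weight M (card \<Theta>) * mse p h (G \<Theta>))"
    unfolding sample_mean_sum sample_mean_cmult
    using mse_eq_sample_mean[of "G _" p h] p by (simp add: G_def)
  finally show ?thesis by (simp add: G_def y_def)
qed

section \<open>From the Bayes risk to lower bounds for edges and stars\<close>

lemma minimax_risk_ge:
  assumes k: "1 \<le> k" "k \<le> d" and M: "M * Suc k \<le> N" and p: "0 \<le> p" "p \<le> 1" and s: "0 \<le> s"
    and rev: "\<And>i. i < M \<Longrightarrow> sample_mean p {..<N} (\<lambda>S. of_bool (i \<in> revealed k M S)) \<le> s"
  shows "ennreal ((real k)\<^sup>2 * ((real M + 2) / 6 * ((real M + 2) / (real M * s + 2) - 1))) \<le> minimax_risk N d p"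
  unfolding minimax_risk_def
proof (rule INF_greatest)
  fix h
  let ?B = "(real k)\<^sup>2 * ((real M + 2) / 6 * ((real M + 2) / (real M * s + 2) - 1))"
  \<comment> \<open>The prior weights are positive and sum to 1, so the largest risk is at least the
    average.\<close>
  have "\<exists>\<Theta>\<in>Pow {..<M}. ?B \<le> mse p h (with_proj (star_forest N k \<Theta>))"
  proof (rule ccontr)
    assume neg: "\<not> ?thesis"
    have less: "mse p h (with_proj (star_forest N k \<Theta>)) < ?B" if "\<Theta> \<in> Pow {..<M}" for \<Theta>
      using neg that by (meson not_le)
    have "(\<Sum>\<Theta>\<in>Pow {..<M}. prior_weight M (card \<Theta>) * mse p h (with_proj (star_forest N k \<Theta>)))
      < (\<Sum>\<Theta>\<in>Pow {..<M}. prior_weight M (card \<Theta>) * ?B)"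
      by (intro sum_strict_mono mult_strict_left_mono less) (auto simp: prior_weight_def)
    also have "\<dots> = ?B"
      unfolding sum_distrib_right[symmetric] using prior_weight_total[of "{..<M}"] by simp
    finally show False using star_forest_bayes_risk[OF k(1) M p s rev, of h] by linarith
  qed
  then obtain \<Theta> where "?B \<le> mse p h (with_proj (star_forest N k \<Theta>))" by auto
  then show "ennreal ?B \<le> (SUP G\<in>forests N d. ennreal (mse p h G))"
    by (intro SUP_upper2[OF star_forest_in_forests[OF k, of N \<Theta>]] ennreal_leI)
qed

text \<open>The closed form is \<open>M (M + 2) (1 - s) / (6 (M s + 2))\<close>. If
  \<open>M s \<le> 2\<close> and \<open>s \<le> 1 / 2\<close>, hardly anything is revealed and it is
  of order \<open>M\<^sup>2\<close>; otherwise \<open>M s + 2\<close> is at most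
  \<open>8 s (M + 2)\<close>.\<close>

lemma risk_bound_cases:
  fixes M :: nat and s :: real
  assumes s: "0 \<le> s" "s \<le> 1"
  defines "\<psi> \<equiv> (real M + 2) / 6 * ((real M + 2) / (real M * s + 2) - 1)"
  shows "(real M)\<^sup>2 / 48 \<le> \<psi> \<or> s > 0 \<and> real M * (1 - s) / (48 * s) \<le> \<psi>"
proof -
  define m where "m = real M"
  have m: "0 \<le> m" by (simp add: m_def)
  have den: "0 < m * s + 2" using m s by (simp add: add_nonneg_pos)
  have \<psi>: "\<psi> = m * (m + 2) * (1 - s) / (6 * (m * s + 2))"
    unfolding \<psi>_def m_def[symmetric] using den by (simp add: field_simps)
  show ?thesis
  proof (cases "m * s \<le> 2 \<and> s \<le> 1 / 2")
    case True
    have "m * (m + 2) * (1 / 2) / (6 * 4) \<le> m * (m + 2) * (1 - s) / (6 * (m * s + 2))"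
      using True m s den by (intro frac_le mult_left_mono mult_nonneg_nonneg) auto
    moreover have "m\<^sup>2 / 48 \<le> m * (m + 2) * (1 / 2) / (6 * 4)"
      using m by (simp add: power2_eq_square algebra_simps)
    ultimately show ?thesis unfolding \<psi> m_def by linarith
  next
    case False
    have s0: "s > 0" using False s m by (cases "s = 0") auto
    have "1 / (8 * s) \<le> (m + 2) / (m * s + 2)"
    proof -
      have "m * s + 2 \<le> 8 * s * (m + 2)"
      proof (cases "s \<le> 1 / 2")
        case True
        then have "m * s > 2" using False by auto
        then show ?thesis using s by (simp add: algebra_simps)
      next
        case False
        have "0 \<le> m * s" using m s by simp
        with False show ?thesis by (simp add: algebra_simps)
      qed
      then show ?thesis using s0 den by (simp add: divide_simps mult_ac)
    qed
    then have "m * (1 - s) / 6 * (1 / (8 * s)) \<le> m * (1 - s) / 6 * ((m + 2) / (m * s + 2))"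
      using m s by (intro mult_left_mono) auto
    then have "m * (1 - s) / (48 * s) \<le> \<psi>" unfolding \<psi> by (simp add: mult_ac)
    with s0 show ?thesis by (simp add: m_def)
  qed
qed

lemma minimax_risk_lower_edges:
  assumes d: "1 \<le> d" and N: "2 \<le> N" and p: "0 \<le> p" "p \<le> 1"
  shows "ennreal ((real N)\<^sup>2 / 432) \<le> minimax_risk N d p \<or>
    p > 0 \<and> ennreal (real N * (1 - p) / p\<^sup>2 / 144) \<le> minimax_risk N d p"
proof -
  define M where "M = N div 2"
  \<comment> \<open>The worst case is \<open>N = 3\<close>. The constants are
    \<open>432 = 9 * 48\<close> and \<open>144 = 3 * 48\<close>.\<close>
  have "N \<le> 3 * M" using N unfolding M_def by presburger
  then have M: "real N / 3 \<le> real M" by linarith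
  have bound: "ennreal ((real M + 2) / 6 * ((real M + 2) / (real M * p\<^sup>2 + 2) - 1)) \<le> minimax_risk N d p"
  proof -
    have "sample_mean p {..<N} (\<lambda>S. of_bool (i \<in> revealed 1 M S)) \<le> p\<^sup>2" if "i < M" for i
    proof -
      have "sample_mean p {..<N} (\<lambda>S. of_bool (i \<in> revealed 1 M S))
        \<le> sample_mean p {..<N} (\<lambda>S. of_bool ({2 * i, 2 * i + 1} \<subseteq> S))"
        by (rule sample_mean_mono[OF p]) (auto simp: revealed_def mult_2)
      also have "\<dots> = p ^ card {2 * i, 2 * i + 1}"
        using that by (intro sample_mean_subset) (auto simp: M_def)
      finally show ?thesis by (simp add: numeral_2_eq_2)
    qed
    from minimax_risk_ge[OF _ d _ p _ this] show ?thesis by (simp add: M_def)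
  qed
  have p2: "0 \<le> p\<^sup>2" "p\<^sup>2 \<le> 1" using p by (auto simp: power_le_one)
  from risk_bound_cases[OF p2, of M] show ?thesis
  proof
    assume *: "(real M)\<^sup>2 / 48 \<le> (real M + 2) / 6 * ((real M + 2) / (real M * p\<^sup>2 + 2) - 1)"
    have "(real N / 3)\<^sup>2 \<le> (real M)\<^sup>2" using M by (intro power_mono) auto
    then have "(real N)\<^sup>2 / 432 \<le> (real M)\<^sup>2 / 48" by (simp add: power_divide)
    with * have "(real N)\<^sup>2 / 432 \<le> (real M + 2) / 6 * ((real M + 2) / (real M * p\<^sup>2 + 2) - 1)" by linarith
    then show ?thesis using bound ennreal_leI order_trans by blast
  next
    assume *: "p\<^sup>2 > 0 \<and> real M * (1 - p\<^sup>2) / (48 * p\<^sup>2) \<le> (real M + 2) / 6 * ((real M + 2) / (real M * p\<^sup>2 + 2) - 1)"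
    then have p0: "p > 0" using p by (cases "p = 0") auto
    have "1 - p \<le> 1 - p\<^sup>2" using p by (simp add: power2_eq_square mult_left_le)
    then have "(real N / 3) * (1 - p) \<le> real M * (1 - p\<^sup>2)" using M p by (intro mult_mono) auto
    then have "(real N / 3) * (1 - p) / (48 * p\<^sup>2) \<le> real M * (1 - p\<^sup>2) / (48 * p\<^sup>2)"
      by (intro divide_right_mono) auto
    then have "real N * (1 - p) / p\<^sup>2 / 144 \<le> (real M + 2) / 6 * ((real M + 2) / (real M * p\<^sup>2 + 2) - 1)"
      using * by (simp add: mult.commute)
    then show ?thesis using p0 bound ennreal_leI order_trans by blast
  qed
qed

lemma minimax_risk_lower_stars:
  assumes d: "1 \<le> d" "d \<le> N" and N: "2 \<le> N" and p: "0 < p" "p \<le> 1"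
  shows "ennreal ((real N)\<^sup>2 / 768) \<le> minimax_risk N d p \<or>
    ennreal (real N * (1 - p) * real d / p / 384) \<le> minimax_risk N d p"
proof -
  \<comment> \<open>A star with its centre must fit into \<open>N\<close> vertices. Since
    \<open>d \<le> N\<close> and \<open>N \<ge> 2\<close>, this costs at most a factor 2 in the
    degree.\<close>
  define k where "k = min d (N - 1)"
  define M where "M = N div Suc k"
  define \<psi> where "\<psi> = (real M + 2) / 6 * ((real M + 2) / (real M * p + 2) - 1)"
  have k: "1 \<le> k" "k \<le> d" "d \<le> 2 * k" "Suc k \<le> N" using d N by (auto simp: k_def)
  have M1: "1 \<le> M" unfolding M_def using k(4) by (simp add: Suc_le_eq div_greater_zero_iff)
  \<comment> \<open>Rounding loses a factor 2 and \<open>k + 1 \<le> 2 k\<close> another, so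
    \<open>k M\<close> is at least \<open>N / 4\<close>. The constants are
    \<open>768 = 16 * 48\<close> and \<open>384 = 4 * 2 * 48\<close>.\<close>
  have "N < M * Suc k + Suc k"
    unfolding M_def using dividend_less_div_times[of "Suc k" N] by (simp add: algebra_simps)
  also have "\<dots> \<le> M * Suc k + M * Suc k" using mult_le_mono1[OF M1, of "Suc k"] by simp
  also have "\<dots> \<le> 4 * (M * k)"
  proof -
    have "M * 1 \<le> M * k" by (rule mult_le_mono2[OF k(1)])
    then show ?thesis unfolding mult_Suc_right by linarith
  qed
  finally have "real N \<le> real (4 * (M * k))" by (intro of_nat_mono) simp
  then have Mk: "real N / 4 \<le> real k * real M" by (simp add: mult.commute)
  have bound: "ennreal ((real k)\<^sup>2 * \<psi>) \<le> minimax_risk N d p"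
    unfolding \<psi>_def
  proof (rule minimax_risk_ge[OF k(1,2)])
    show "M * Suc k \<le> N" unfolding M_def by (rule div_times_less_eq_dividend)
    then have lt: "i * Suc k < N" if "i < M" for i
      using that by (meson less_le_trans mult_less_mono1 zero_less_Suc)
    show "sample_mean p {..<N} (\<lambda>S. of_bool (i \<in> revealed k M S)) \<le> p" if "i < M" for i
    proof -
      have "sample_mean p {..<N} (\<lambda>S. of_bool (i \<in> revealed k M S))
        \<le> sample_mean p {..<N} (\<lambda>S. of_bool ({i * Suc k} \<subseteq> S))"
        by (rule sample_mean_mono) (use p in \<open>auto simp: revealed_def\<close>)
      also have "\<dots> = p ^ card {i * Suc k}"
        using lt[OF that] by (intro sample_mean_subset) auto
      finally show ?thesis by simp
    qed
  qed (use p in auto)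
  from risk_bound_cases[of p M, folded \<psi>_def] p
  have "(real M)\<^sup>2 / 48 \<le> \<psi> \<or> real M * (1 - p) / (48 * p) \<le> \<psi>" by auto
  then show ?thesis
  proof
    assume "(real M)\<^sup>2 / 48 \<le> \<psi>"
    then have "(real k)\<^sup>2 * ((real M)\<^sup>2 / 48) \<le> (real k)\<^sup>2 * \<psi>" by (intro mult_left_mono) auto
    moreover have "(real N / 4)\<^sup>2 \<le> (real k * real M)\<^sup>2" using Mk by (intro power_mono) auto
    ultimately have "(real N)\<^sup>2 / 768 \<le> (real k)\<^sup>2 * \<psi>" by (simp add: power_divide power_mult_distrib)
    then show ?thesis using bound ennreal_leI order_trans by blast
  next
    assume "real M * (1 - p) / (48 * p) \<le> \<psi>"
    then have "(real k)\<^sup>2 * (real M * (1 - p) / (48 * p)) \<le> (real k)\<^sup>2 * \<psi>" by (intro mult_left_mono) auto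
    moreover have "(real N / 4) * (real d / 2) \<le> (real k * real M) * real k"
      using Mk k(3) by (intro mult_mono) auto
    then have "(real N / 4) * (real d / 2) * ((1 - p) / (48 * p)) \<le> (real k * real M) * real k * ((1 - p) / (48 * p))"
      using p by (intro mult_right_mono) auto
    ultimately have "real N * (1 - p) * real d / p / 384 \<le> (real k)\<^sup>2 * \<psi>"
      by (simp add: power2_eq_square mult_ac)
    then show ?thesis using bound ennreal_leI order_trans by blast
  qed
qed

section \<open>Combination of the two lower bounds\<close>

lemma minimax_risk_lower:
  assumes d: "1 \<le> d" "d \<le> N" and N: "2 \<le> N" and p: "0 \<le> p" "p \<le> 1"
  shows "ennreal (1 / 768 * rate N d p) \<le> minimax_risk N d p"
proof -
  have scale: "ennreal (1 / 768 * rate N d p) \<le> minimax_risk N d p"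
    if "ennreal x \<le> minimax_risk N d p" "1 / 768 * rate N d p \<le> x" for x
    using that ennreal_leI order_trans by blast
  have N2: "rate N d p \<le> (real N)\<^sup>2" by (auto simp: rate_def Let_def)
  have N0: "0 \<le> (real N)\<^sup>2" by simp
  show ?thesis
  \<comment> \<open>Edges serve when the first term of the maximum dominates and when
    \<open>p = 0\<close>; stars serve when the second term is larger.\<close>
  proof (cases "p = 0 \<or> real N * (1 - p) * real d / p \<le> real N * (1 - p) / p\<^sup>2")
    case True
    have A0: "0 \<le> real N * (1 - p) / p\<^sup>2" using p by simp
    have A: "rate N d p \<le> real N * (1 - p) / p\<^sup>2" if "p > 0"
      using True that by (auto simp: rate_def Let_def)
    show ?thesis using minimax_risk_lower_edges[OF d(1) N p]
    proof
      assume "ennreal ((real N)\<^sup>2 / 432) \<le> minimax_risk N d p"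
      then show ?thesis by (rule scale) (use N2 N0 in linarith)
    next
      assume *: "p > 0 \<and> ennreal (real N * (1 - p) / p\<^sup>2 / 144) \<le> minimax_risk N d p"
      have "1 / 768 * r \<le> x / 144" if "r \<le> x" "0 \<le> x" for r x :: real
        using that by linarith
      from scale[OF conjunct2[OF *] this[OF A[OF conjunct1[OF *]] A0]] show ?thesis .
    qed
  next
    case False
    then have p0: "p > 0" using p by auto
    have B0: "0 \<le> real N * (1 - p) * real d / p" using p by simp
    have B: "rate N d p \<le> real N * (1 - p) * real d / p"
      using False by (auto simp: rate_def Let_def)
    show ?thesis using minimax_risk_lower_stars[OF d N p0 p(2)]
    proof
      assume "ennreal ((real N)\<^sup>2 / 768) \<le> minimax_risk N d p"
      then show ?thesis by (rule scale) (use N2 in linarith)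
    next
      assume *: "ennreal (real N * (1 - p) * real d / p / 384) \<le> minimax_risk N d p"
      have "1 / 768 * r \<le> x / 384" if "r \<le> x" "0 \<le> x" for r x :: real
        using that by linarith
      from scale[OF * this[OF B B0]] show ?thesis .
    qed
  qed
qed

theorem theorem2:
  shows "\<exists>c C :: real. 0 < c \<and> 0 < C \<and>
    (\<forall>(N :: nat) (d :: nat) (p :: real).
       1 \<le> d \<longrightarrow> d \<le> N \<longrightarrow> 0 \<le> p \<longrightarrow> p \<le> 1 \<longrightarrow>
         (2 \<le> N \<longrightarrow> ennreal (c * rate N d p) \<le> minimax_risk N d p) \<and>
         minimax_risk N d p \<le> ennreal (C * rate N d p))"
proof (rule exI[of _ "1 / 768"], rule exI[of _ 8], intro conjI allI impI)
  fix N d :: nat and p :: real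
  assume *: "1 \<le> d" "d \<le> N" "0 \<le> p" "p \<le> 1"
  show "minimax_risk N d p \<le> ennreal (8 * rate N d p)"
    using * by (intro minimax_risk_upper)
  assume "2 \<le> N"
  with * show "ennreal (1 / 768 * rate N d p) \<le> minimax_risk N d p"
    by (intro minimax_risk_lower)
qed simp_all

end
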